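(* Let $k$ be a fixed positive integer. For every $\delta>0$ there is $n_0=n_0(k,\delta)$ such that the following holds for all $n\ge n_0$: if $S$ is a family of $n$ pairwise intersecting closed curves in the plane in general position, each of which can be decomposed into at most $k$ $x$-monotone curves, then the total number of intersection points between the curves of $S$ is at least $(1-\delta)n^2$. (That is, the number of intersection points is at least $(1-o_k(1))n^2$.)
   Context: Closed curves are simple closed (Jordan) curves in the plane. A family of curves is in general position if no three curves pass through the same point and no two curves share infinitely many points. An open curve is $x$-monotone if no two of its points have the same $x$-coordinate. A closed curve can be decomposed into at most $k$ $x$-monotone curves if it is the union of at most $k$ $x$-monotone arcs. Two curves touch if they have precisely one point in common, at which they do not properly cross; this point is a touching point. All other common points of two curves are crossing points. An intersection point is a touching point or a crossing point. Two curves intersect if they have at least one common point. *)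

theory Defs
  imports "HOL-Analysis.Analysis"
begin

text \<open>The plane is \<^typ>\<open>complex\<close>, with \<^const>\<open>Re\<close> as the \<open>x\<close>-coordinate; curves are point sets.\<close>

definition closed_curve :: "complex set \<Rightarrow> bool" where
  "closed_curve C \<longleftrightarrow>
     (\<exists>g. simple_path g \<and> pathfinish g = pathstart g \<and> path_image g = C)"

definition open_curve :: "complex set \<Rightarrow> bool" where
  "open_curve A \<longleftrightarrow> (\<exists>g. arc g \<and> path_image g = A)"

definition x_monotone :: "complex set \<Rightarrow> bool" where
  "x_monotone A \<longleftrightarrow> open_curve A \<and> inj_on Re A"

definition x_monotone_decomposable :: "nat \<Rightarrow> complex set \<Rightarrow> bool" where
  "x_monotone_decomposable k C \<longleftrightarrow>
     (\<exists>\<A>. finite \<A> \<and> card \<A> \<le> k \<and> (\<forall>A\<in>\<A>. x_monotone A) \<and> C = \<Union>\<A>)"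

definition general_position :: "complex set set \<Rightarrow> bool" where
  "general_position S \<longleftrightarrow>
     (\<forall>A\<in>S. \<forall>B\<in>S. \<forall>C\<in>S. A \<noteq> B \<and> A \<noteq> C \<and> B \<noteq> C \<longrightarrow> A \<inter> B \<inter> C = {}) \<and>
     (\<forall>A\<in>S. \<forall>B\<in>S. A \<noteq> B \<longrightarrow> finite (A \<inter> B))"

definition pairwise_intersecting :: "complex set set \<Rightarrow> bool" where
  "pairwise_intersecting S \<longleftrightarrow> pairwise (\<lambda>A B. A \<inter> B \<noteq> {}) S"

text \<open>
  \<open>B\<close> passes at \<open>p\<close> from one side of the Jordan curve \<open>A\<close> to the other. Reversing the
  parametrization \<open>g\<close> of \<open>B\<close> swaps the two sides, so fixing which of them is
  \<^term>\<open>inside A\<close> is no restriction.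
\<close>

definition properly_cross_at :: "complex set \<Rightarrow> complex set \<Rightarrow> complex \<Rightarrow> bool" where
  "properly_cross_at A B p \<longleftrightarrow> p \<in> A \<and>
     (\<exists>g. simple_path g \<and> pathstart g = p \<and> pathfinish g = p \<and> path_image g = B \<and>
       (\<exists>\<epsilon>>0. \<epsilon> < 1/2 \<and> (\<forall>t\<in>{0<..<\<epsilon>}. g t \<in> inside A) \<and>
                       (\<forall>t\<in>{1-\<epsilon><..<1}. g t \<in> outside A)))"

definition touching_point :: "complex set \<Rightarrow> complex set \<Rightarrow> complex \<Rightarrow> bool" where
  "touching_point A B p \<longleftrightarrow> A \<inter> B = {p} \<and> \<not> properly_cross_at A B p"

definition crossing_point :: "complex set \<Rightarrow> complex set \<Rightarrow> complex \<Rightarrow> bool" where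
  "crossing_point A B p \<longleftrightarrow> p \<in> A \<inter> B \<and> \<not> touching_point A B p"

definition intersection_point :: "complex set \<Rightarrow> complex set \<Rightarrow> complex \<Rightarrow> bool" where
  "intersection_point A B p \<longleftrightarrow> touching_point A B p \<or> crossing_point A B p"

definition intersection_points :: "complex set set \<Rightarrow> complex set" where
  "intersection_points S = {p. \<exists>A\<in>S. \<exists>B\<in>S. A \<noteq> B \<and> intersection_point A B p}"

end

theory Submission imports Defs begin

text \<open>
  Two of the curves meet at least twice unless they have a single common point, so it suffices to
  show that \<open>o(n\<^sup>2)\<close> pairs are of the latter kind, given that there are \<open>O(n\<^sup>2)\<close> intersections in
  total. By the Jordan curve theorem the curves of such a pair do not cross, so one of the \<open>x\<close>-monotone
  arcs at the common point lies below the other; by pigeonhole we fix the indices of the two arcs.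

  If a lower arc \<open>a\<close> touches two upper arcs, these two cross between the two touching points, and
  symmetrically. Fix a scale \<open>w\<close>. Consecutive touchings on \<open>a\<close> at distance at most \<open>w\<close> produce
  crossings of upper arcs; if crossings were only linearly many in the number \<open>T\<close> of touchings, then
  a double count would give \<open>\<Omega>(w\<^sup>2 T)\<close> four-cycles of touchings with \<open>O(w)\<close> touchings inside. In each of
  them the two lower arcs cross twice, forming a lens that contains one of its touchings. Counting the
  four-cycles by their lenses, the lenses of size at most \<open>O(w)\<close> have total size \<open>\<Omega>(w T)\<close>. A lens
  contributes substantially only at scales comparable to its size, so summing over many dyadic
  scales forces the number of crossings to exceed any multiple of \<open>T\<close> once \<open>T / n\<close> is large.
\<close>

section \<open>Counting\<close>

text \<open>Arcs of different curves live over different ranges, so crossings alone cannot separate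
  two touchings; events are therefore abscissae of common points together with slightly shifted ends
  of arcs. The ends cost four events per ordered pair, which is affordable because \<open>T\<close>
  is quadratic in the case to be refuted: if the theorem failed, there would be at most
  \<open>6 * n^2\<close> events, while \<open>T\<close> would be at least
  \<open>\<delta> * n^2 / (2 * k^2)\<close>. Hence there are at most \<open>K\<close> events per
  touching, where \<open>K\<close> depends only on \<open>k\<close> and \<open>\<delta>\<close>. A
  single scale \<open>w\<close> gives no contradiction, since \<open>K * T\<close> events could all
  start lenses of size about \<open>w\<close>. But the charge of one lens over all scales is of
  order \<open>K^3\<close>, so all lenses together are charged \<open>O(K^4 * T)\<close>, while each
  scale demands \<open>T\<close>; a number of scales of order \<open>K^4\<close> suffices. The
  largest scale must be at most \<open>T / (2 * n)\<close>, which makes the final bound on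
  \<open>T\<close> linear in \<open>n\<close> with a factor exponential in
  \<open>K^4\<close>.\<close>

lemma card_double_count_le:
  assumes "finite X" "finite Y"
    and "\<And>c. c \<in> X \<Longrightarrow> H \<le> card {y \<in> Y. R c y}"
    and "\<And>y. y \<in> Y \<Longrightarrow> card {c \<in> X. R c y} \<le> N"
  shows "H * card X \<le> N * card Y"
proof -
  have "H * card X \<le> (\<Sum>c\<in>X. card {y \<in> Y. R c y})"
    using sum_mono[of X "\<lambda>_. H"] assms(3) by (simp add: mult.commute)
  also have "\<dots> = (\<Sum>y\<in>Y. card {c \<in> X. R c y})"
    by (rule sum_multicount_gen) (use assms in auto)
  also have "\<dots> \<le> N * card Y"
    using sum_mono[of Y _ "\<lambda>_. N"] assms(4) by (simp add: mult.commute)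
  finally show ?thesis .
qed

text \<open>Cauchy-Schwarz over the fibres of \<open>\<psi>\<close>: the pairs with equal image,
  those of the form \<open>(c, c)\<close> included, number the sum of the squared fibre
  sizes.\<close>

lemma card_pairs_same_image_ge:
  assumes "finite Q" "finite Y" "\<psi> ` Q \<subseteq> Y"
  shows "(card Q)\<^sup>2 \<le> card Y * card {(c, d). c \<in> Q \<and> d \<in> Q \<and> \<psi> c = \<psi> d}"
proof -
  let ?F = "\<lambda>y. {c \<in> Q. \<psi> c = y}"
  have cardQ: "card Q = (\<Sum>y\<in>Y. card (?F y))"
  proof -
    have "Q = (\<Union>y\<in>Y. ?F y)" using assms(3) by auto
    also have "card \<dots> = (\<Sum>y\<in>Y. card (?F y))"
      using assms(1,2) by (intro card_UN_disjoint) auto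
    finally show ?thesis .
  qed
  have "{(c, d). c \<in> Q \<and> d \<in> Q \<and> \<psi> c = \<psi> d} = (\<Union>y\<in>Y. ?F y \<times> ?F y)"
    using assms(3) by (fastforce simp: image_subset_iff)
  also have "card \<dots> = (\<Sum>y\<in>Y. card (?F y \<times> ?F y))"
    using assms(1,2) by (intro card_UN_disjoint) auto
  also have "\<dots> = (\<Sum>y\<in>Y. (card (?F y))\<^sup>2)"
    by (simp add: card_cartesian_product power2_eq_square)
  finally have P: "card {(c, d). c \<in> Q \<and> d \<in> Q \<and> \<psi> c = \<psi> d} = (\<Sum>y\<in>Y. (card (?F y))\<^sup>2)" .
  have "(real (card Q))\<^sup>2 = (\<Sum>y\<in>Y. real (card (?F y)))\<^sup>2"
    by (simp add: cardQ)
  also have "\<dots> \<le> (\<Sum>y\<in>Y. (real (card (?F y)))\<^sup>2) * card Y"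
    by (rule sum_squared_le_sum_of_squares)
  also have "\<dots> = real (card Y * (\<Sum>y\<in>Y. (card (?F y))\<^sup>2))"
    by simp
  finally have "real ((card Q)\<^sup>2) \<le> real (card Y * (\<Sum>y\<in>Y. (card (?F y))\<^sup>2))"
    by simp
  then show ?thesis unfolding P by (simp only: of_nat_le_iff)
qed

section \<open>Close pairs in a linear order\<close>

lemma card_last_ranks_ge:
  fixes f :: "'a \<Rightarrow> real"
  assumes "finite S" "inj_on f S" "w \<le> card S"
  shows "w \<le> card {b \<in> S. card {c \<in> S. f b \<le> f c} \<le> w}"
proof -
  define g where "g b = card {c \<in> S. f b \<le> f c}" for b
  have less: "g c < g b" if "b \<in> S" "c \<in> S" "f b < f c" for b c
    unfolding g_def
  proof (rule psubset_card_mono)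
    have "b \<notin> {d \<in> S. f c \<le> f d}" "b \<in> {d \<in> S. f b \<le> f d}" using that by auto
    moreover have "{d \<in> S. f c \<le> f d} \<subseteq> {d \<in> S. f b \<le> f d}" using that by auto
    ultimately show "{d \<in> S. f c \<le> f d} \<subset> {d \<in> S. f b \<le> f d}" by blast
  qed (use assms in auto)
  have inj: "inj_on g S"
  proof (rule inj_onI)
    fix b c assume "b \<in> S" "c \<in> S" "g b = g c"
    then show "b = c"
      using less[of b c] less[of c b] assms(2) by (metis inj_onD less_irrefl linorder_neqE)
  qed
  have "g b \<ge> 1" if "b \<in> S" for b
  proof -
    have "{c \<in> S. f b \<le> f c} \<noteq> {}" using that by auto
    then show ?thesis unfolding g_def using assms(1) by (simp add: Suc_le_eq card_gt_0_iff)
  qed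
  moreover have "g b \<le> card S" for b
    unfolding g_def using assms(1) by (intro card_mono) auto
  ultimately have "g ` S \<subseteq> {1..card S}" by auto
  \<comment> \<open>The ranks are injective and have only \<open>card S\<close> possible values, so
    every rank from 1 to \<open>w\<close> is attained.\<close>
  then have img: "g ` S = {1..card S}"
    by (intro card_subset_eq) (auto simp: card_image inj)
  have "{1..w} \<subseteq> g ` {b \<in> S. g b \<le> w}"
  proof
    fix v assume v: "v \<in> {1..w}"
    then have "v \<in> g ` S" unfolding img using assms(3) by auto
    then show "v \<in> g ` {b \<in> S. g b \<le> w}" using v by auto
  qed
  then have "card {1..w} \<le> card {b \<in> S. g b \<le> w}"
    using assms(1) by (intro surj_card_le) auto
  then show ?thesis by (simp add: g_def)
qed

text \<open>When elements are inserted in increasing order, each new maximum is close to the last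
  \<open>w\<close> of its predecessors. The term \<open>w * w\<close> pays for the initial elements,
  which have too few predecessors; the window \<open>w + 1\<close> counts both ends of a
  pair.\<close>

lemma card_close_pairs_ge:
  fixes f :: "'a \<Rightarrow> real"
  assumes "finite S" "inj_on f S"
  shows "w * card S \<le>
    card {(b, c). b \<in> S \<and> c \<in> S \<and> f b < f c \<and> card {d \<in> S. f b \<le> f d \<and> f d \<le> f c} \<le> w + 1} + w * w"
  using assms
proof (induction S rule: finite_ranking_induct[where f = f])
  case empty
  then show ?case by simp
next
  case (insert x S)
  let ?P = "\<lambda>S. {(b, c). b \<in> S \<and> c \<in> S \<and> f b < f c \<and> card {d \<in> S. f b \<le> f d \<and> f d \<le> f c} \<le> w + 1}"
  have fin: "finite (?P S)" if "finite S" for S :: "'a set"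
    using that by (rule_tac finite_subset[of _ "S \<times> S"]) auto
  show ?case
  proof (cases "x \<in> S \<or> card S < w")
    case True
    then show ?thesis
    proof
      assume "x \<in> S"
      then show ?thesis using insert by (simp add: insert_absorb)
    next
      assume "card S < w"
      then have "card (insert x S) \<le> w" using insert.hyps by (simp add: card_insert_if)
      then show ?thesis by (meson mult_le_mono2 trans_le_add2)
    qed
  next
    case False
    then have xS: "x \<notin> S" and wS: "w \<le> card S" by auto
    have injS: "inj_on f S" using insert.prems by auto
    have lt: "f y < f x" if "y \<in> S" for y
      using insert.hyps(2)[OF that] insert.prems that xS by (auto simp: inj_on_def less_le)
    let ?N = "(\<lambda>b. (b, x)) ` {b \<in> S. card {c \<in> S. f b \<le> f c} \<le> w}"
    have sub: "?P S \<union> ?N \<subseteq> ?P (insert x S)"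
    proof (intro Un_least subsetI)
      fix z assume "z \<in> ?P S"
      then obtain b c where z: "z = (b, c)" "b \<in> S" "c \<in> S" "f b < f c"
        "card {d \<in> S. f b \<le> f d \<and> f d \<le> f c} \<le> w + 1" by auto
      have "{d \<in> insert x S. f b \<le> f d \<and> f d \<le> f c} = {d \<in> S. f b \<le> f d \<and> f d \<le> f c}"
        using lt[OF z(3)] by auto
      then show "z \<in> ?P (insert x S)" using z by simp
    next
      fix z assume "z \<in> ?N"
      then obtain b where z: "z = (b, x)" "b \<in> S" "card {c \<in> S. f b \<le> f c} \<le> w" by auto
      have "{d \<in> insert x S. f b \<le> f d \<and> f d \<le> f x} = insert x {c \<in> S. f b \<le> f c}"
        using insert.hyps(2) lt[OF z(2)] by auto
      then have "card {d \<in> insert x S. f b \<le> f d \<and> f d \<le> f x} \<le> w + 1"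
        using z(3) insert.hyps(1) xS by simp
      then show "z \<in> ?P (insert x S)" using z lt[OF z(2)] by auto
    qed
    have "card (?P S) + card ?N = card (?P S \<union> ?N)"
      using xS fin insert.hyps(1) by (intro card_Un_disjoint[symmetric]) auto
    also have "\<dots> \<le> card (?P (insert x S))"
      using sub fin[of "insert x S"] insert.hyps(1) by (intro card_mono) auto
    finally have 1: "card (?P S) + card ?N \<le> card (?P (insert x S))" .
    have "card ?N = card {b \<in> S. card {c \<in> S. f b \<le> f c} \<le> w}"
      by (rule card_image) (auto simp: inj_on_def)
    then have "w \<le> card ?N"
      using card_last_ranks_ge[OF insert.hyps(1) injS wS] by simp
    with 1 insert.IH[OF injS] xS insert.hyps(1) show ?thesis by simp
  qed
qed

text \<open>All counted elements lie between the lowest of them and \<open>e\<close>, and that range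
  contains at most \<open>m\<close> elements of \<open>S\<close>.\<close>

lemma card_close_below_le:
  fixes f :: "'a \<Rightarrow> real"
  assumes "finite S"
  shows "card {b \<in> S. f b \<le> e \<and> card {c \<in> S. f b \<le> f c \<and> f c \<le> e} \<le> m} \<le> m" (is "card ?Y \<le> m")
proof (cases "?Y = {}")
  case False
  define b where "b = arg_min_on f ?Y"
  have fin: "finite ?Y" using assms by auto
  have b: "b \<in> ?Y" unfolding b_def by (rule arg_min_if_finite[OF fin False])
  have "?Y \<subseteq> {c \<in> S. f b \<le> f c \<and> f c \<le> e}"
    using arg_min_least[OF fin False, of _ f] unfolding b_def by auto
  then have "card ?Y \<le> card {c \<in> S. f b \<le> f c \<and> f c \<le> e}"
    using assms by (intro card_mono) auto
  with b show ?thesis by auto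
next
  case True
  then show ?thesis by (metis card.empty le0)
qed

lemma card_close_above_le:
  fixes f :: "'a \<Rightarrow> real"
  assumes "finite S"
  shows "card {b \<in> S. e \<le> f b \<and> card {c \<in> S. e \<le> f c \<and> f c \<le> f b} \<le> m} \<le> m"
  using card_close_below_le[OF assms, of "\<lambda>b. - f b" "- e" m] by (simp add: conj_commute)

text \<open>Only terms with \<open>2 ^ i \<ge> l / c\<close> survive; the first is at most
  \<open>c\<close> and they halve from there on. The bound uses \<open>min c l\<close> instead of
  \<open>c\<close> for the induction: splitting off \<open>i = 0\<close> leaves the same sum for
  \<open>l / 2\<close>, and when \<open>l \<le> c\<close> the term \<open>l\<close> has to be
  absorbed.\<close>

lemma sum_dyadic_truncated_le:
  fixes c l :: real
  assumes "0 < c" "0 \<le> l"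
  shows "(\<Sum>i<R. if l \<le> c * 2 ^ i then l / 2 ^ i else 0) \<le> 2 * min c l"
  using assms(2)
proof (induction R arbitrary: l)
  case 0
  then show ?case using assms(1) by simp
next
  case (Suc R)
  have "(\<Sum>i<Suc R. if l \<le> c * 2 ^ i then l / 2 ^ i else 0)
      = (if l \<le> c then l else 0) + (\<Sum>i<R. if l / 2 \<le> c * 2 ^ i then (l / 2) / 2 ^ i else 0)"
    by (subst sum.lessThan_Suc_shift) (auto intro!: arg_cong2[where f = "(+)"] sum.cong simp: field_simps)
  also have "\<dots> \<le> (if l \<le> c then l else 0) + 2 * min c (l / 2)"
    using Suc.IH[of "l / 2"] Suc.prems by simp
  also have "\<dots> \<le> 2 * min c l" using assms(1) Suc.prems by (auto simp: min_def)
  finally show ?case .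
qed

lemma card_le_Suc_card_partners:
  assumes "finite Ev" "\<And>c. c \<in> S \<Longrightarrow> c \<noteq> z \<Longrightarrow> \<exists>e. (u, c, e) \<in> Ev"
  shows "card S \<le> card Ev + 1"
proof -
  have "S - {z} \<subseteq> (\<lambda>(u, c, e). c) ` Ev" using assms(2) by force
  then have "card (S - {z}) \<le> card Ev" "finite (S - {z})"
    using assms(1) surj_card_le finite_subset[OF _ finite_imageI] by blast+
  then show ?thesis by (auto simp: card_Diff_singleton_if split: if_splits)
qed

lemma card_Sigma_le:
  assumes "finite A" "card A \<le> m" "\<And>a. a \<in> A \<Longrightarrow> finite (B a) \<and> card (B a) \<le> n"
  shows "card (Sigma A B) \<le> m * n"
proof -
  have "card (Sigma A B) = (\<Sum>a\<in>A. card (B a))"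
    using assms by (intro card_SigmaI) auto
  also have "\<dots> \<le> card A * n"
    using sum_bounded_above[of A "\<lambda>a. card (B a)" n] assms(3) by auto
  also have "\<dots> \<le> m * n" using assms(2) by simp
  finally show ?thesis .
qed

section \<open>Systems of touchings\<close>

text \<open>
  \<open>G\<close> records that the lower curve \<open>a\<close> touches the upper curve \<open>b\<close>, at abscissa \<open>x a b\<close>.
  The sets \<open>EA a a'\<close> and \<open>EB b b'\<close> of events stand for the abscissae where two lower, respectively two
  upper, curves may swap their vertical order. Two lower curves touching the same upper curve must
  swap between the two touchings. Pairs are ordered throughout, so every event is counted twice.
\<close>

locale touching_system =
  fixes G :: "('a \<times> 'b) set" and x :: "'a \<Rightarrow> 'b \<Rightarrow> real"
    and EA :: "'a \<Rightarrow> 'a \<Rightarrow> real set" and EB :: "'b \<Rightarrow> 'b \<Rightarrow> real set"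
  assumes finite_G: "finite G"
    and finite_EA: "\<And>a a'. a \<in> fst ` G \<Longrightarrow> a' \<in> fst ` G \<Longrightarrow> a \<noteq> a' \<Longrightarrow> finite (EA a a')"
    and finite_EB: "\<And>b b'. b \<in> snd ` G \<Longrightarrow> b' \<in> snd ` G \<Longrightarrow> b \<noteq> b' \<Longrightarrow> finite (EB b b')"
    and sepA: "\<And>a a' b. (a, b) \<in> G \<Longrightarrow> (a', b) \<in> G \<Longrightarrow> a \<noteq> a' \<Longrightarrow>
      \<exists>e\<in>EA a a'. min (x a b) (x a' b) < e \<and> e < max (x a b) (x a' b)"
    and sepB: "\<And>a b b'. (a, b) \<in> G \<Longrightarrow> (a, b') \<in> G \<Longrightarrow> b \<noteq> b' \<Longrightarrow>
      \<exists>e\<in>EB b b'. min (x a b) (x a b') < e \<and> e < max (x a b) (x a b')"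
begin

definition "EvA = {(a, a', e). a \<in> fst ` G \<and> a' \<in> fst ` G \<and> a \<noteq> a' \<and> e \<in> EA a a'}"
definition "EvB = {(b, b', e). b \<in> snd ` G \<and> b' \<in> snd ` G \<and> b \<noteq> b' \<and> e \<in> EB b b'}"
definition "evA a s t = {(a1, a', e). (a1, a', e) \<in> EvA \<and> a1 = a \<and> s < e \<and> e < t}"
definition "evB b s t = {(b1, b', e). (b1, b', e) \<in> EvB \<and> b1 = b \<and> s < e \<and> e < t}"
definition "nbA a = {b. (a, b) \<in> G}"
definition "nbB b = {a. (a, b) \<in> G}"
definition "touchA a s t = {b \<in> nbA a. s \<le> x a b \<and> x a b \<le> t}"
definition "touchB b s t = {a \<in> nbB b. s \<le> x a b \<and> x a b \<le> t}"

text \<open>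
  The number \<open>w\<close> is the scale: \<open>a\<close> has at most \<open>w + 1\<close> touchings from \<open>b\<close> to \<open>b'\<close> inclusive.
\<close>

definition "cherries w = {(a, b, b'). (a, b) \<in> G \<and> (a, b') \<in> G \<and> x a b < x a b' \<and>
  card (touchA a (x a b) (x a b')) \<le> w + 1}"

lemma finite_EvA: "finite EvA"
proof -
  have "EvA = (SIGMA a:fst ` G. SIGMA a':fst ` G - {a}. EA a a')"
    unfolding EvA_def by auto
  then show ?thesis
    by (simp only:) (intro finite_SigmaI finite_Diff finite_imageI finite_G finite_EA; auto)
qed

lemma finite_EvB: "finite EvB"
proof -
  have "EvB = (SIGMA b:snd ` G. SIGMA b':snd ` G - {b}. EB b b')"
    unfolding EvB_def by auto
  then show ?thesis
    by (simp only:) (intro finite_SigmaI finite_Diff finite_imageI finite_G finite_EB; auto)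
qed

lemma finite_evA: "finite (evA a s t)" and finite_evB: "finite (evB b s t)"
  by (rule finite_subset[OF _ finite_EvA], auto simp: evA_def)
    (rule finite_subset[OF _ finite_EvB], auto simp: evB_def)

lemma finite_nbA: "finite (nbA a)" and finite_nbB: "finite (nbB b)"
proof -
  show "finite (nbA a)"
    by (rule finite_subset[of _ "snd ` G"]) (use finite_G in \<open>force simp: nbA_def\<close>)+
  show "finite (nbB b)"
    by (rule finite_subset[of _ "fst ` G"]) (use finite_G in \<open>force simp: nbB_def\<close>)+
qed

lemma finite_touchA: "finite (touchA a s t)"
  using finite_nbA by (simp add: touchA_def)

lemma inj_on_nbA: "inj_on (x a) (nbA a)"
proof (rule inj_onI, rule ccontr)
  fix b b' assume "b \<in> nbA a" "b' \<in> nbA a" "x a b = x a b'" "b \<noteq> b'"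
  then show False using sepB[of a b b'] by (auto simp: nbA_def)
qed

text \<open>Every other curve touching \<open>b\<close> in the interval swaps with \<open>a\<close> there.\<close>

lemma card_touchB_le:
  assumes "(a, b) \<in> G" "s \<le> x a b" "x a b \<le> t"
  shows "card (touchB b s t) \<le> card (evA a s t) + 1"
proof (rule card_le_Suc_card_partners[where u = a and z = a])
  fix c assume c: "c \<in> touchB b s t" "c \<noteq> a"
  then have "(c, b) \<in> G" by (simp add: touchB_def nbB_def)
  with assms c sepA[of a b c] obtain e where "e \<in> EA a c"
    "min (x a b) (x c b) < e" "e < max (x a b) (x c b)" by auto
  moreover have "a \<in> fst ` G" "c \<in> fst ` G"
    using assms(1) \<open>(c, b) \<in> G\<close> by force+
  ultimately have "(a, c, e) \<in> evA a s t"
    using c assms by (auto simp: evA_def EvA_def touchB_def)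
  then show "\<exists>e. (a, c, e) \<in> evA a s t" ..
qed (rule finite_evA)

lemma card_touchA_le:
  assumes "(a, b) \<in> G" "s \<le> x a b" "x a b \<le> t"
  shows "card (touchA a s t) \<le> card (evB b s t) + 1"
proof (rule card_le_Suc_card_partners[where u = b and z = b])
  fix c assume c: "c \<in> touchA a s t" "c \<noteq> b"
  then have "(a, c) \<in> G" by (simp add: touchA_def nbA_def)
  with assms c sepB[of a b c] obtain e where "e \<in> EB b c"
    "min (x a b) (x a c) < e" "e < max (x a b) (x a c)" by auto
  moreover have "b \<in> snd ` G" "c \<in> snd ` G"
    using assms(1) \<open>(a, c) \<in> G\<close> by force+
  ultimately have "(b, c, e) \<in> evB b s t"
    using c assms by (auto simp: evB_def EvB_def touchA_def)
  then show "\<exists>e. (b, c, e) \<in> evB b s t" ..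
qed (rule finite_evB)

lemma finite_cherries: "finite (cherries w)"
proof (rule finite_subset)
  show "cherries w \<subseteq> fst ` G \<times> snd ` G \<times> snd ` G"
    by (force simp: cherries_def)
qed (use finite_G in auto)

text \<open>The close pairs are counted on each lower curve separately, with a loss of
  \<open>w * w\<close> per curve. The loss is at most half of \<open>w * card G\<close> once lower
  curves have at least \<open>2 * w\<close> touchings on average.\<close>

lemma card_cherries_ge: "w * card G \<le> card (cherries w) + w * w * card (fst ` G)"
proof -
  let ?P = "\<lambda>a. {(b, c). b \<in> nbA a \<and> c \<in> nbA a \<and> x a b < x a c \<and>
    card {d \<in> nbA a. x a b \<le> x a d \<and> x a d \<le> x a c} \<le> w + 1}"
  have finP: "finite (?P a)" for a
    by (rule finite_subset[of _ "nbA a \<times> nbA a"]) (auto simp: finite_nbA)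
  have "cherries w = (SIGMA a:fst ` G. ?P a)"
    by (auto simp: cherries_def nbA_def touchA_def intro: rev_image_eqI)
  then have cC: "card (cherries w) = (\<Sum>a\<in>fst ` G. card (?P a))"
    using finP finite_G by (simp only:) (intro card_SigmaI; simp)
  have "G = (SIGMA a:fst ` G. nbA a)"
    by (auto simp: nbA_def intro: rev_image_eqI)
  then have "card G = card (SIGMA a:fst ` G. nbA a)"
    by (rule arg_cong)
  also have "\<dots> = (\<Sum>a\<in>fst ` G. card (nbA a))"
    using finite_nbA finite_G by (intro card_SigmaI) auto
  finally have cG: "card G = (\<Sum>a\<in>fst ` G. card (nbA a))" .
  have "w * card G = (\<Sum>a\<in>fst ` G. w * card (nbA a))"
    by (simp add: cG sum_distrib_left)
  also have "\<dots> \<le> (\<Sum>a\<in>fst ` G. card (?P a) + w * w)"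
    by (intro sum_mono card_close_pairs_ge finite_nbA inj_on_nbA)
  also have "\<dots> = card (cherries w) + w * w * card (fst ` G)"
    by (simp add: cC sum.distrib)
  finally show ?thesis .
qed

section \<open>Cherries with few events\<close>

definition "calm L w = {(a, b, b'). (a, b, b') \<in> cherries w \<and> card (evA a (x a b) (x a b')) \<le> L}"

text \<open>The bounds come in two stages. An event on \<open>b\<close> can be charged to few
  cherries only if \<open>b\<close> has few touchings in their intervals; calmness guarantees this
  through \<open>card_touchB_le\<close>, and only then can busy upper curves be counted.\<close>

definition "tame L H w = {(a, b, b'). (a, b, b') \<in> calm L w \<and>
  card (evB b (x a b) (x a b')) \<le> H \<and> card (evB b' (x a b) (x a b')) \<le> H}"

lemma cherryD:
  assumes "(a, b, b') \<in> cherries w"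
  shows "(a, b) \<in> G" "(a, b') \<in> G" "x a b < x a b'" "card (touchA a (x a b) (x a b')) \<le> w + 1"
    "b \<in> nbA a" "b' \<in> nbA a" "a \<in> nbB b" "a \<in> nbB b'"
  using assms by (auto simp: cherries_def nbA_def nbB_def)

text \<open>An event on \<open>a\<close> lies inside at most \<open>(w + 1) * (w + 1)\<close>
  cherries: the left touching is among the \<open>w + 1\<close> nearest before it, the right one
  among the \<open>w + 1\<close> nearest after it.\<close>

lemma card_not_calm:
  "L * card (cherries w - calm L w) \<le> (w + 1) * (w + 1) * card EvA"
proof (rule card_double_count_le[where R = "\<lambda>(a, b, b') y. y \<in> evA a (x a b) (x a b')"])
  fix c assume c: "c \<in> cherries w - calm L w"
  obtain a b b' where abb: "c = (a, b, b')" by (cases c)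
  have "{y \<in> EvA. y \<in> evA a (x a b) (x a b')} = evA a (x a b) (x a b')"
    by (auto simp: evA_def)
  then show "L \<le> card {y \<in> EvA. (case c of (a, b, b') \<Rightarrow> \<lambda>y. y \<in> evA a (x a b) (x a b')) y}"
    using c abb by (auto simp: calm_def)
next
  fix y assume "y \<in> EvA"
  obtain a a' e where y: "y = (a, a', e)" by (cases y)
  let ?l = "{b \<in> nbA a. x a b \<le> e \<and> card {d \<in> nbA a. x a b \<le> x a d \<and> x a d \<le> e} \<le> w + 1}"
  let ?r = "{b \<in> nbA a. e \<le> x a b \<and> card {d \<in> nbA a. e \<le> x a d \<and> x a d \<le> x a b} \<le> w + 1}"
  have sub: "{c \<in> cherries w - calm L w. (case c of (a, b, b') \<Rightarrow> \<lambda>y. y \<in> evA a (x a b) (x a b')) y}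
      \<subseteq> Pair a ` (?l \<times> ?r)"
  proof clarify
    fix a1 b b' assume *: "(a1, b, b') \<in> cherries w" "y \<in> evA a1 (x a1 b) (x a1 b')"
    then have a: "a1 = a" "x a b < e" "e < x a b'" by (auto simp: y evA_def)
    note ch = cherryD[OF *(1)[unfolded a(1)]]
    have "card {d \<in> nbA a. x a b \<le> x a d \<and> x a d \<le> e} \<le> card (touchA a (x a b) (x a b'))"
      "card {d \<in> nbA a. e \<le> x a d \<and> x a d \<le> x a b'} \<le> card (touchA a (x a b) (x a b'))"
      using a finite_nbA by (auto intro!: card_mono simp: touchA_def)
    then show "(a1, b, b') \<in> Pair a ` (?l \<times> ?r)"
      using a ch by auto
  qed
  have fin: "finite ?l" "finite ?r" using finite_nbA by auto
  have "card (Pair a ` (?l \<times> ?r)) \<le> card (?l \<times> ?r)"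
    by (rule card_image_le) (use fin in auto)
  also have "\<dots> \<le> (w + 1) * (w + 1)"
    unfolding card_cartesian_product
    by (intro mult_le_mono card_close_below_le card_close_above_le finite_nbA)
  finally have le: "card (Pair a ` (?l \<times> ?r)) \<le> (w + 1) * (w + 1)" .
  have "finite (Pair a ` (?l \<times> ?r))" using fin by blast
  from card_mono[OF this sub] le
  show "card {c \<in> cherries w - calm L w. (case c of (a, b, b') \<Rightarrow> \<lambda>y. y \<in> evA a (x a b) (x a b')) y}
      \<le> (w + 1) * (w + 1)" by (rule le_trans)
qed (use finite_cherries finite_EvA in auto)

lemma card_ahead_le:
  "card {b' \<in> nbA a. x a b \<le> x a b' \<and> card (touchA a (x a b) (x a b')) \<le> w + 1} \<le> w + 1"
  unfolding touchA_def by (rule card_close_above_le) (rule finite_nbA)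

lemma card_behind_le:
  "card {b' \<in> nbA a. x a b' \<le> x a b \<and> card (touchA a (x a b') (x a b)) \<le> w + 1} \<le> w + 1"
  unfolding touchA_def by (rule card_close_below_le) (rule finite_nbA)

lemma calm_touchB:
  assumes "(a, b, b') \<in> calm L w"
  shows "card (touchB b (x a b) (x a b')) \<le> L + 1" "card (touchB b' (x a b) (x a b')) \<le> L + 1"
  using assms card_touchB_le[of a b "x a b" "x a b'"] card_touchB_le[of a b' "x a b" "x a b'"]
  by (auto simp: calm_def cherries_def)

text \<open>An event on \<open>b\<close> lies inside few calm cherries with left end
  \<open>b\<close>: calmness leaves at most \<open>L + 1\<close> choices of \<open>a\<close> among
  the touchings of \<open>b\<close> before the event, and for given \<open>a\<close> there are at
  most \<open>w + 1\<close> choices of \<open>b'\<close>.\<close>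

lemma card_busy_left:
  "H * card {(a, b, b'). (a, b, b') \<in> calm L w \<and> H < card (evB b (x a b) (x a b'))}
    \<le> (L + 1) * (w + 1) * card EvB" (is "_ * card ?X \<le> _")
proof (rule card_double_count_le[where R = "\<lambda>(a, b, b') y. y \<in> evB b (x a b) (x a b')"])
  show "finite ?X" by (rule finite_subset[OF _ finite_cherries[of w]]) (auto simp: calm_def)
  fix c assume c: "c \<in> ?X"
  obtain a b b' where abb: "c = (a, b, b')" by (cases c)
  have "{y \<in> EvB. y \<in> evB b (x a b) (x a b')} = evB b (x a b) (x a b')"
    by (auto simp: evB_def)
  then show "H \<le> card {y \<in> EvB. (case c of (a, b, b') \<Rightarrow> \<lambda>y. y \<in> evB b (x a b) (x a b')) y}"
    using c abb by auto
next
  fix y assume "y \<in> EvB"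
  obtain b b'' e where y: "y = (b, b'', e)" by (cases y)
  let ?l = "{a \<in> nbB b. x a b \<le> e \<and> card {d \<in> nbB b. x a b \<le> x d b \<and> x d b \<le> e} \<le> L + 1}"
  let ?r = "\<lambda>a. {b' \<in> nbA a. x a b \<le> x a b' \<and> card (touchA a (x a b) (x a b')) \<le> w + 1}"
  have sub: "{c \<in> ?X. (case c of (a, b, b') \<Rightarrow> \<lambda>y. y \<in> evB b (x a b) (x a b')) y}
      \<subseteq> (\<lambda>(a, b'). (a, b, b')) ` Sigma ?l ?r"
  proof clarify
    fix a b1 b' assume *: "(a, b1, b') \<in> calm L w" "y \<in> evB b1 (x a b1) (x a b')"
    then have b: "b1 = b" "x a b < e" "e < x a b'" by (auto simp: y evB_def)
    have ch: "(a, b, b') \<in> cherries w" using * b by (auto simp: calm_def)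
    have "card {d \<in> nbB b. x a b \<le> x d b \<and> x d b \<le> e} \<le> card (touchB b (x a b) (x a b'))"
      using b finite_nbB by (auto intro!: card_mono simp: touchB_def)
    then have "(a, b') \<in> Sigma ?l ?r"
      using b cherryD[OF ch] calm_touchB(1)[OF *(1)[unfolded b(1)]] by auto
    then show "(a, b1, b') \<in> (\<lambda>(a, b'). (a, b, b')) ` Sigma ?l ?r"
      using b(1) by (intro image_eqI[of _ _ "(a, b')"]) auto
  qed
  have fin: "finite ?l" "finite (?r a)" for a by (simp_all add: finite_nbA finite_nbB)
  then have finS: "finite (Sigma ?l ?r)" by (rule finite_SigmaI)
  have "card (Sigma ?l ?r) \<le> (L + 1) * (w + 1)"
    using fin by (intro card_Sigma_le conjI card_ahead_le card_close_below_le[OF finite_nbB])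
  then show "card {c \<in> ?X. (case c of (a, b, b') \<Rightarrow> \<lambda>y. y \<in> evB b (x a b) (x a b')) y}
      \<le> (L + 1) * (w + 1)"
    using surj_card_le[OF finS sub] by linarith
qed (rule finite_EvB)

text \<open>The mirror image of \<open>card_busy_left\<close>: the event lies on the right upper
  curve, so \<open>a\<close> ranges over touchings after the event and \<open>b\<close> over those
  behind \<open>b'\<close>.\<close>

lemma card_busy_right:
  "H * card {(a, b, b'). (a, b, b') \<in> calm L w \<and> H < card (evB b' (x a b) (x a b'))}
    \<le> (L + 1) * (w + 1) * card EvB" (is "_ * card ?X \<le> _")
proof (rule card_double_count_le[where R = "\<lambda>(a, b, b') y. y \<in> evB b' (x a b) (x a b')"])
  show "finite ?X" by (rule finite_subset[OF _ finite_cherries[of w]]) (auto simp: calm_def)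
  fix c assume c: "c \<in> ?X"
  obtain a b b' where abb: "c = (a, b, b')" by (cases c)
  have "{y \<in> EvB. y \<in> evB b' (x a b) (x a b')} = evB b' (x a b) (x a b')"
    by (auto simp: evB_def)
  then show "H \<le> card {y \<in> EvB. (case c of (a, b, b') \<Rightarrow> \<lambda>y. y \<in> evB b' (x a b) (x a b')) y}"
    using c abb by auto
next
  fix y assume "y \<in> EvB"
  obtain b' b'' e where y: "y = (b', b'', e)" by (cases y)
  let ?l = "{a \<in> nbB b'. e \<le> x a b' \<and> card {d \<in> nbB b'. e \<le> x d b' \<and> x d b' \<le> x a b'} \<le> L + 1}"
  let ?r = "\<lambda>a. {b \<in> nbA a. x a b \<le> x a b' \<and> card (touchA a (x a b) (x a b')) \<le> w + 1}"
  have sub: "{c \<in> ?X. (case c of (a, b, b') \<Rightarrow> \<lambda>y. y \<in> evB b' (x a b) (x a b')) y}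
      \<subseteq> (\<lambda>(a, b). (a, b, b')) ` Sigma ?l ?r"
  proof clarify
    fix a b b1 assume *: "(a, b, b1) \<in> calm L w" "y \<in> evB b1 (x a b) (x a b1)"
    then have b: "b1 = b'" "x a b < e" "e < x a b'" by (auto simp: y evB_def)
    have ch: "(a, b, b') \<in> cherries w" using * b by (auto simp: calm_def)
    have "card {d \<in> nbB b'. e \<le> x d b' \<and> x d b' \<le> x a b'} \<le> card (touchB b' (x a b) (x a b'))"
      using b finite_nbB by (auto intro!: card_mono simp: touchB_def)
    then have "(a, b) \<in> Sigma ?l ?r"
      using b cherryD[OF ch] calm_touchB(2)[OF *(1)[unfolded b(1)]] by auto
    then show "(a, b, b1) \<in> (\<lambda>(a, b). (a, b, b')) ` Sigma ?l ?r"
      using b(1) by (intro image_eqI[of _ _ "(a, b)"]) auto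
  qed
  have fin: "finite ?l" "finite (?r a)" for a by (simp_all add: finite_nbA finite_nbB)
  then have finS: "finite (Sigma ?l ?r)" by (rule finite_SigmaI)
  have "card (Sigma ?l ?r) \<le> (L + 1) * (w + 1)"
    using fin by (intro card_Sigma_le conjI card_behind_le card_close_above_le[OF finite_nbB])
  then show "card {c \<in> ?X. (case c of (a, b, b') \<Rightarrow> \<lambda>y. y \<in> evB b' (x a b) (x a b')) y}
      \<le> (L + 1) * (w + 1)"
    using surj_card_le[OF finS sub] by linarith
qed (rule finite_EvB)

lemma card_cherries_le_tame:
  "card (cherries w) \<le> card (tame L H w) + card (cherries w - calm L w)
    + card {(a, b, b'). (a, b, b') \<in> calm L w \<and> H < card (evB b (x a b) (x a b'))}
    + card {(a, b, b'). (a, b, b') \<in> calm L w \<and> H < card (evB b' (x a b) (x a b'))}"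
    (is "_ \<le> card ?A + card ?B + card ?C + card ?D")
proof -
  have "cherries w \<subseteq> ?A \<union> ?B \<union> ?C \<union> ?D"
  proof (rule subsetI)
    fix c assume c: "c \<in> cherries w"
    obtain a b b' where "c = (a, b, b')" by (cases c)
    with c show "c \<in> ?A \<union> ?B \<union> ?C \<union> ?D"
      by (simp add: tame_def) linarith
  qed
  moreover have "?A \<union> ?B \<union> ?C \<union> ?D \<subseteq> cherries w" by (auto simp: tame_def calm_def)
  ultimately have "cherries w = ?A \<union> ?B \<union> ?C \<union> ?D" by (rule subset_antisym)
  then have "card (cherries w) = card (?A \<union> ?B \<union> ?C \<union> ?D)" by (rule arg_cong)
  also have "\<dots> \<le> card (?A \<union> ?B \<union> ?C) + card ?D" by (rule card_Un_le)
  also have "card (?A \<union> ?B \<union> ?C) \<le> card (?A \<union> ?B) + card ?C" by (rule card_Un_le)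
  also have "card (?A \<union> ?B) \<le> card ?A + card ?B" by (rule card_Un_le)
  finally show ?thesis by simp
qed

text \<open>At least half of \<open>w * card G\<close> survives in \<open>cherries w\<close>. The
  value of \<open>L\<close> limits the cherries that are not calm to an eighth of
  \<open>w * card G\<close>, that of \<open>H\<close> limits those busy on either upper curve to a
  sixteenth each, so a quarter remains.\<close>

lemma card_tame_ge:
  fixes K w :: nat
  assumes K: "K \<ge> 1" and w: "w \<ge> 1" and n: "2 * w * card (fst ` G) \<le> card G"
    and XA: "card EvA \<le> K * card G" and XB: "card EvB \<le> K * card G"
  shows "w * card G \<le> 4 * card (tame (32 * K * w) (2048 * K\<^sup>2 * w) w)"
proof -
  define T where "T = card G"
  let ?L = "32 * K * w" and ?H = "2048 * K\<^sup>2 * w"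
  define u where "u = card (cherries w - calm ?L w)"
  define v where "v = card {(a, b, b'). (a, b, b') \<in> calm ?L w \<and> ?H < card (evB b (x a b) (x a b'))}"
  define v' where "v' = card {(a, b, b'). (a, b, b') \<in> calm ?L w \<and> ?H < card (evB b' (x a b) (x a b'))}"
  have w1: "w + 1 \<le> 2 * w" using w by simp
  have Lw: "?L + 1 \<le> 64 * K * w"
  proof -
    have "1 \<le> K * w" using K w by simp
    then show ?thesis by simp
  qed
  have "?L * u \<le> (w + 1) * (w + 1) * (K * T)"
    using card_not_calm[of ?L w] XA unfolding u_def T_def by (meson le_trans mult_le_mono2)
  also have "\<dots> \<le> (2 * w) * (2 * w) * (K * T)"
    using w1 by (intro mult_le_mono) auto
  finally have "(4 * K * w) * (8 * u) \<le> (4 * K * w) * (w * T)" by (simp add: algebra_simps)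
  moreover have "0 < 4 * K * w" using K w by simp
  ultimately have u: "8 * u \<le> w * T" by (simp only: nat_mult_le_cancel1)
  have cancel: "16 * y \<le> w * T" if "?H * y \<le> (?L + 1) * (w + 1) * card EvB" for y
  proof -
    have "?H * y \<le> (?L + 1) * (w + 1) * (K * T)"
      using that XB unfolding T_def by (meson le_trans mult_le_mono2)
    also have "\<dots> \<le> (64 * K * w) * (2 * w) * (K * T)"
      using w1 Lw by (intro mult_le_mono) auto
    finally have "(128 * K\<^sup>2 * w) * (16 * y) \<le> (128 * K\<^sup>2 * w) * (w * T)"
      by (simp add: algebra_simps power2_eq_square)
    moreover have "0 < 128 * K\<^sup>2 * w" using K w by simp
    ultimately show ?thesis by (simp only: nat_mult_le_cancel1)
  qed
  have v: "16 * v \<le> w * T" unfolding v_def by (rule cancel[OF card_busy_left])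
  have v': "16 * v' \<le> w * T" unfolding v'_def by (rule cancel[OF card_busy_right])
  have "w * (2 * w * card (fst ` G)) \<le> w * T" using n unfolding T_def by (rule mult_le_mono2)
  then have "2 * (w * w * card (fst ` G)) \<le> w * T" by (simp add: algebra_simps)
  then have "w * T \<le> 2 * card (cherries w)"
    using card_cherries_ge[of w] unfolding T_def by linarith
  moreover have "card (cherries w) \<le> card (tame ?L ?H w) + u + v + v'"
    unfolding u_def v_def v'_def by (rule card_cherries_le_tame)
  ultimately show ?thesis using u v v' unfolding T_def by linarith
qed

section \<open>Four-cycles of touchings and their lenses\<close>

definition "mark = (\<lambda>(a, b, b'). (b, b', SOME e. e \<in> EB b b' \<and> x a b < e \<and> e < x a b'))"

text \<open>
  The touchings of \<open>a\<close> after the event \<open>f\<close> and up to the next event of the pair \<open>a, a'\<close>; all later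
  touchings of \<open>a\<close> if there is no next event.
\<close>

definition "lens = (\<lambda>(a, a', f). {b \<in> nbA a. f < x a b \<and> (\<forall>g\<in>EA a a'. f < g \<longrightarrow> x a b \<le> g)})"

text \<open>Equal marks mean the same \<open>b\<close> and \<open>b'\<close> and one common event
  inside both cherries, so the four touchings form a four-cycle whose two intervals overlap. The
  condition on \<open>x\<close> fixes the order of \<open>a\<close> and \<open>a'\<close>.\<close>

definition "linked L H w = {(a, a', b, b'). (a, b, b') \<in> tame L H w \<and> (a', b, b') \<in> tame L H w \<and>
  mark (a, b, b') = mark (a', b, b') \<and> x a' b < x a b}"

lemma tame_cherries: "tame L H w \<subseteq> cherries w"
  by (auto simp: tame_def calm_def)

lemma finite_tame: "finite (tame L H w)"
  by (rule finite_subset[OF tame_cherries finite_cherries])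

lemma finite_lens: "finite (lens ev)"
  by (cases ev) (simp add: lens_def finite_nbA)

lemma mark_cherry:
  assumes "(a, b, b') \<in> cherries w"
  obtains e where "mark (a, b, b') = (b, b', e)" "e \<in> EB b b'" "x a b < e" "e < x a b'"
proof -
  note ch = cherryD[OF assms]
  have "b \<noteq> b'" using ch(3) by auto
  with sepB[OF ch(1,2)] ch(3) have "\<exists>e. e \<in> EB b b' \<and> x a b < e \<and> e < x a b'" by auto
  from someI_ex[OF this] show ?thesis by (intro that[of "SOME e. e \<in> EB b b' \<and> x a b < e \<and> e < x a b'"]) (auto simp: mark_def)
qed

lemma mark_tame: "mark ` tame L H w \<subseteq> EvB"
proof (rule image_subsetI)
  fix c assume c: "c \<in> tame L H w"
  obtain a b b' where abb: "c = (a, b, b')" by (cases c)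
  then have ch: "(a, b, b') \<in> cherries w" using c tame_cherries by auto
  obtain e where e: "mark (a, b, b') = (b, b', e)" "e \<in> EB b b'" "x a b < e" "e < x a b'"
    by (rule mark_cherry[OF ch])
  have "b \<in> snd ` G" "b' \<in> snd ` G" using cherryD(1,2)[OF ch] by (auto intro: rev_image_eqI)
  moreover have "b \<noteq> b'" using cherryD(3)[OF ch] by auto
  ultimately show "mark c \<in> EvB" using e by (simp add: EvB_def abb)
qed

text \<open>Cauchy-Schwarz on the fibres of \<open>mark\<close>: a pair with equal marks is a cherry
  paired with itself or a linked quadruple in one of its two orders.\<close>

lemma card_tame_linked:
  "(card (tame L H w))\<^sup>2 \<le> card EvB * (card (tame L H w) + 2 * card (linked L H w))"
proof -
  let ?Q = "tame L H w" and ?P = "linked L H w"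
  let ?D = "(\<lambda>c. (c, c)) ` ?Q"
  let ?f = "\<lambda>(a, a', b, b'). ((a, b, b'), (a', b, b'))"
  let ?g = "\<lambda>(a, a', b, b'). ((a', b, b'), (a, b, b'))"
  have finP: "finite ?P"
  proof (rule finite_subset)
    show "?P \<subseteq> fst ` G \<times> fst ` G \<times> snd ` G \<times> snd ` G"
      using tame_cherries[of L H w]
      by (auto simp: linked_def dest!: subsetD[OF tame_cherries] dest: cherryD(1,2) intro: rev_image_eqI)
  qed (simp add: finite_G)
  have sub: "{(c, d). c \<in> ?Q \<and> d \<in> ?Q \<and> mark c = mark d} \<subseteq> ?D \<union> ?f ` ?P \<union> ?g ` ?P"
  proof (rule subsetI)
    fix z assume z: "z \<in> {(c, d). c \<in> ?Q \<and> d \<in> ?Q \<and> mark c = mark d}"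
    obtain a b b' a1 b1 b1' where z': "z = ((a, b, b'), (a1, b1, b1'))" by (metis prod.exhaust)
    with z have q: "(a, b, b') \<in> ?Q" "(a1, b1, b1') \<in> ?Q" "mark (a, b, b') = mark (a1, b1, b1')" by auto
    then have eq: "b1 = b" "b1' = b'" by (auto simp: mark_def)
    show "z \<in> ?D \<union> ?f ` ?P \<union> ?g ` ?P"
    proof (cases "a = a1")
      case True
      then show ?thesis using z' q eq by auto
    next
      case False
      have "(a, b) \<in> G" "(a1, b) \<in> G"
        using q eq tame_cherries[of L H w] cherryD(1) by blast+
      from sepA[OF this False] have "x a b \<noteq> x a1 b" by auto
      then consider "x a1 b < x a b" | "x a b < x a1 b" by linarith
      then show ?thesis
      proof cases
        case 1
        then have "(a, a1, b, b') \<in> ?P" using q eq by (simp add: linked_def)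
        then have "z \<in> ?f ` ?P" using z' eq by (intro image_eqI) auto
        then show ?thesis by blast
      next
        case 2
        then have "(a1, a, b, b') \<in> ?P" using q eq by (simp add: linked_def)
        then have "z \<in> ?g ` ?P" using z' eq by (intro image_eqI) auto
        then show ?thesis by blast
      qed
    qed
  qed
  have fin: "finite (?D \<union> ?f ` ?P \<union> ?g ` ?P)" using finP finite_tame by simp
  have "card {(c, d). c \<in> ?Q \<and> d \<in> ?Q \<and> mark c = mark d} \<le> card (?D \<union> ?f ` ?P \<union> ?g ` ?P)"
    by (rule card_mono[OF fin sub])
  also have "\<dots> \<le> card (?D \<union> ?f ` ?P) + card (?g ` ?P)" by (rule card_Un_le)
  also have "card (?D \<union> ?f ` ?P) \<le> card ?D + card (?f ` ?P)" by (rule card_Un_le)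
  also have "card ?D \<le> card ?Q" by (rule card_image_le[OF finite_tame])
  also have "card (?f ` ?P) \<le> card ?P" by (rule card_image_le[OF finP])
  also have "card (?g ` ?P) \<le> card ?P" by (rule card_image_le[OF finP])
  finally have "card {(c, d). c \<in> ?Q \<and> d \<in> ?Q \<and> mark c = mark d} \<le> card ?Q + 2 * card ?P" by simp
  with card_pairs_same_image_ge[OF finite_tame finite_EvB mark_tame[of L H w]] show ?thesis
    by (meson le_trans mult_le_mono2)
qed

text \<open>
  The curves \<open>a, a', b, b'\<close> touch in a four-cycle, in the order \<open>(a', b)\<close>, \<open>(a, b)\<close>, then both touchings
  of \<open>b'\<close>. So \<open>a\<close> and \<open>a'\<close> swap before \<open>(a, b)\<close> and again after it, and the lens around
  \<open>(a, b)\<close> fits inside the four-cycle; tameness bounds the number of touchings of \<open>a\<close> there.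
\<close>

lemma linked_lens:
  assumes "(a, a', b, b') \<in> linked L H w"
  obtains f where "(a, a', f) \<in> EvA" "b \<in> lens (a, a', f)" "card (lens (a, a', f)) \<le> w + 3 + 2 * H"
proof -
  have t: "(a, b, b') \<in> tame L H w" "(a', b, b') \<in> tame L H w"
    and m: "mark (a, b, b') = mark (a', b, b')" and lt: "x a' b < x a b"
    using assms by (auto simp: linked_def)
  have ch: "(a, b, b') \<in> cherries w" and ch': "(a', b, b') \<in> cherries w"
    using t tame_cherries by auto
  note c = cherryD[OF ch] and c' = cherryD[OF ch']
  obtain e where m1: "mark (a, b, b') = (b, b', e)" "e \<in> EB b b'" "x a b < e" "e < x a b'"
    by (rule mark_cherry[OF ch])
  obtain e' where m2: "mark (a', b, b') = (b, b', e')" "e' \<in> EB b b'" "x a' b < e'" "e' < x a' b'"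
    by (rule mark_cherry[OF ch'])
  have e: "x a b < e" "e < x a b'" "x a' b < e" "e < x a' b'"
    using m m1 m2 by auto
  have aa: "a \<noteq> a'" using lt by auto
  have V: "a \<in> fst ` G" "a' \<in> fst ` G" using c(1) c'(1) by force+
  note finE = finite_EA[OF V aa]
  \<comment> \<open>The lens around \<open>b\<close> starts at the last event of \<open>a\<close>
    and \<open>a'\<close> before the touching \<open>(a, b)\<close>. There is one, since both curves
    touch \<open>b\<close> and \<open>a'\<close> does so earlier.\<close>
  define F where "F = {f \<in> EA a a'. f < x a b}"
  from sepA[OF c(1) c'(1) aa] lt obtain f0 where f0: "f0 \<in> EA a a'" "x a' b < f0" "f0 < x a b" by auto
  have finF: "finite F" and "f0 \<in> F" using finE f0 by (auto simp: F_def)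
  define f where "f = Max F"
  have f: "f \<in> EA a a'" "f < x a b" "x a' b < f"
    using Max_in[OF finF] Max_ge[OF finF \<open>f0 \<in> F\<close>] \<open>f0 \<in> F\<close> f0 by (auto simp: f_def F_def)
  have nextf: "x a b \<le> g" if "g \<in> EA a a'" "f < g" for g
    using Max_ge[OF finF, of g] that by (force simp: f_def F_def)
  have ev: "(a, a', f) \<in> EvA" using V aa f by (simp add: EvA_def)
  have bl: "b \<in> lens (a, a', f)" using c(5) f nextf by (simp add: lens_def)
  \<comment> \<open>This event lies between the touchings with \<open>b'\<close>, hence after
    \<open>e\<close> and after \<open>f\<close>, so the lens ends there at the latest.\<close>
  from sepA[OF c(2) c'(2) aa] obtain g where g: "g \<in> EA a a'"
    "min (x a b') (x a' b') < g" "g < max (x a b') (x a' b')" by auto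
  have gf: "f < g" using g(2) e f by auto
  let ?t = "max (x a b') (x a' b')"
  \<comment> \<open>The cherry condition bounds the middle range by \<open>w + 1\<close>; the outer
    two are bounded through events on \<open>b\<close> and on \<open>b'\<close>, by
    \<open>card_touchA_le\<close>.\<close>
  have "lens (a, a', f) \<subseteq> touchA a (x a' b) (x a b) \<union> touchA a (x a b) (x a b') \<union> touchA a (x a b') ?t"
  proof (rule subsetI)
    fix d assume "d \<in> lens (a, a', f)"
    then have "d \<in> nbA a" "f < x a d" "x a d \<le> g" using g(1) gf by (auto simp: lens_def)
    then show "d \<in> touchA a (x a' b) (x a b) \<union> touchA a (x a b) (x a b') \<union> touchA a (x a b') ?t"
      using f g by (auto simp: touchA_def)
  qed
  then have "card (lens (a, a', f)) \<le> card (touchA a (x a' b) (x a b) \<union> touchA a (x a b) (x a b') \<union> touchA a (x a b') ?t)"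
    by (intro card_mono) (simp add: finite_touchA)
  also have "\<dots> \<le> card (touchA a (x a' b) (x a b) \<union> touchA a (x a b) (x a b')) + card (touchA a (x a b') ?t)"
    by (rule card_Un_le)
  also have "card (touchA a (x a' b) (x a b) \<union> touchA a (x a b) (x a b'))
      \<le> card (touchA a (x a' b) (x a b)) + card (touchA a (x a b) (x a b'))"
    by (rule card_Un_le)
  finally have le: "card (lens (a, a', f))
      \<le> card (touchA a (x a' b) (x a b)) + card (touchA a (x a b) (x a b')) + card (touchA a (x a b') ?t)"
    by simp
  have evmono: "card (evB d s1 t1) \<le> card (evB d s t)" if "s \<le> s1" "t1 \<le> t" for d s s1 t t1
    using that by (intro card_mono finite_evB) (auto simp: evB_def)
  \<comment> \<open>Tameness is applied to the cherry of \<open>a'\<close>: its interval covers both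
    outer ranges, unless the right one shrinks to a single abscissa.\<close>
  have H: "card (evB b (x a' b) (x a' b')) \<le> H" "card (evB b' (x a' b) (x a' b')) \<le> H"
    using t(2) by (auto simp: tame_def)
  have "card (touchA a (x a' b) (x a b)) \<le> card (evB b (x a' b) (x a b)) + 1"
    using lt by (intro card_touchA_le[OF c(1)]) auto
  also have "card (evB b (x a' b) (x a b)) \<le> card (evB b (x a' b) (x a' b'))"
    using e by (intro evmono) auto
  finally have 1: "card (touchA a (x a' b) (x a b)) \<le> H + 1" using H(1) by simp
  have 3: "card (touchA a (x a b') ?t) \<le> H + 1"
  proof (cases "x a b' \<le> x a' b'")
    case True
    have "card (touchA a (x a b') ?t) \<le> card (evB b' (x a b') ?t) + 1"
      by (intro card_touchA_le[OF c(2)]) auto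
    also have "card (evB b' (x a b') ?t) \<le> card (evB b' (x a' b) (x a' b'))"
      using e True by (intro evmono) auto
    finally show ?thesis using H(2) by simp
  next
    case False
    have "card (touchA a (x a b') ?t) \<le> card (evB b' (x a b') ?t) + 1"
      by (intro card_touchA_le[OF c(2)]) auto
    also have "evB b' (x a b') ?t = {}" using False by (auto simp: evB_def)
    finally show ?thesis by simp
  qed
  from le 1 3 c(4) have "card (lens (a, a', f)) \<le> w + 3 + 2 * H" by linarith
  with ev bl show ?thesis by (rule that)
qed

text \<open>A linked quadruple is recovered from the event that starts its lens, the touching
  \<open>b\<close> inside that lens and one of at most \<open>w + 1\<close> choices of
  \<open>b'\<close> ahead of \<open>b\<close> on \<open>a\<close>.\<close>

lemma card_linked_le:
  "card (linked L H w) \<le> (w + 1) * (\<Sum>ev\<in>{ev \<in> EvA. card (lens ev) \<le> w + 3 + 2 * H}. card (lens ev))"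
proof -
  let ?E = "{ev \<in> EvA. card (lens ev) \<le> w + 3 + 2 * H}"
  let ?r = "\<lambda>a b. {b' \<in> nbA a. x a b \<le> x a b' \<and> card (touchA a (x a b) (x a b')) \<le> w + 1}"
  let ?S = "SIGMA ev:?E. SIGMA b:lens ev. ?r (fst ev) b"
  let ?h = "\<lambda>((a, a', f), (b, b')). (a, a', b, b')"
  have finr: "finite (?r a b)" for a b by (simp add: finite_nbA)
  have finE: "finite ?E" using finite_EvA by simp
  have finS: "finite ?S" by (intro finite_SigmaI finE finite_lens finr)
  have sub: "linked L H w \<subseteq> ?h ` ?S"
  proof (rule subsetI)
    fix z assume z: "z \<in> linked L H w"
    obtain a a' b b' where z': "z = (a, a', b, b')" by (metis prod.exhaust)
    obtain f where f: "(a, a', f) \<in> EvA" "b \<in> lens (a, a', f)" "card (lens (a, a', f)) \<le> w + 3 + 2 * H"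
      using linked_lens[OF z[unfolded z']] .
    have "(a, b, b') \<in> cherries w" using z z' tame_cherries[of L H w] by (auto simp: linked_def)
    note ch = cherryD[OF this]
    have "((a, a', f), (b, b')) \<in> ?S" using f ch by auto
    then show "z \<in> ?h ` ?S" by (rule rev_image_eqI) (simp add: z')
  qed
  have "card (linked L H w) \<le> card ?S" by (rule surj_card_le[OF finS sub])
  also have "\<dots> = (\<Sum>ev\<in>?E. card (SIGMA b:lens ev. ?r (fst ev) b))"
    by (intro card_SigmaI finE ballI finite_SigmaI finite_lens finr)
  also have "\<dots> \<le> (\<Sum>ev\<in>?E. card (lens ev) * (w + 1))"
    by (intro sum_mono card_Sigma_le finite_lens conjI finr card_ahead_le order_refl)
  also have "\<dots> = (w + 1) * (\<Sum>ev\<in>?E. card (lens ev))"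
    by (subst sum_distrib_right[symmetric]) (rule mult.commute)
  finally show ?thesis .
qed

text \<open>The inequality \<open>card_tame_linked\<close> could be satisfied by cherries paired
  with themselves. The condition \<open>w \<ge> 8 * K\<close> makes the tame cherries at least
  \<open>2 * K * card G\<close>, so these trivial pairs account for at most half of the square and
  linked quadruples must supply the rest.\<close>

lemma scale_bound:
  fixes K w :: nat
  assumes K: "K \<ge> 1" and w: "w \<ge> 8 * K" and n: "2 * w * card (fst ` G) \<le> card G"
    and XA: "card EvA \<le> K * card G" and XB: "card EvB \<le> K * card G"
  shows "w * card G \<le> 128 * K * (\<Sum>ev\<in>{ev \<in> EvA. card (lens ev) \<le> 8192 * K\<^sup>2 * w}. card (lens ev))"
proof (cases "card G = 0")
  case False
  define T where "T = card G"
  let ?L = "32 * K * w" and ?H = "2048 * K\<^sup>2 * w"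
  define q where "q = card (tame ?L ?H w)"
  define p where "p = card (linked ?L ?H w)"
  define \<Sigma> where "\<Sigma> = (\<Sum>ev\<in>{ev \<in> EvA. card (lens ev) \<le> 8192 * K\<^sup>2 * w}. card (lens ev))"
  have w1: "w \<ge> 1" using K w by simp
  have T: "T > 0" using False by (simp add: T_def)
  have qT: "w * T \<le> 4 * q"
    unfolding T_def q_def by (rule card_tame_ge[OF K w1 n XA XB])
  have "8 * (K * T) \<le> w * T" using mult_le_mono1[OF w, of T] by (simp only: mult.assoc)
  then have KT: "2 * (K * T) \<le> q" using qT by linarith
  have "q\<^sup>2 \<le> card EvB * (q + 2 * p)"
    unfolding p_def q_def by (rule card_tame_linked)
  also have "\<dots> \<le> (K * T) * (q + 2 * p)" using XB unfolding T_def by (rule mult_le_mono1)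
  finally have "2 * q\<^sup>2 \<le> 2 * (K * T) * q + 4 * (K * T * p)" by (simp add: algebra_simps)
  also have "2 * (K * T) * q \<le> q * q" using KT by (rule mult_le_mono1)
  finally have "q\<^sup>2 \<le> 4 * (K * T * p)" by (simp add: power2_eq_square)
  moreover have "(w * T)\<^sup>2 \<le> (4 * q)\<^sup>2" using qT by (rule power_mono) simp
  ultimately have "(w * T)\<^sup>2 \<le> 64 * (K * T * p)" by (simp add: power_mult_distrib)
  then have "T * (w * w * T) \<le> T * (64 * K * p)" by (simp add: power2_eq_square algebra_simps)
  then have 1: "w * w * T \<le> 64 * K * p" using T by (simp only: nat_mult_le_cancel1)
  have "p \<le> (w + 1) * (\<Sum>ev\<in>{ev \<in> EvA. card (lens ev) \<le> w + 3 + 2 * ?H}. card (lens ev))"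
    unfolding p_def by (rule card_linked_le)
  also have "\<dots> \<le> (2 * w) * \<Sigma>"
    unfolding \<Sigma>_def
  proof (intro mult_le_mono sum_mono2)
    show "w + 1 \<le> 2 * w" using w1 by simp
    show "finite {ev \<in> EvA. card (lens ev) \<le> 8192 * K\<^sup>2 * w}" using finite_EvA by simp
    have "1 * w \<le> K\<^sup>2 * w" using K by (intro mult_le_mono1) simp
    \<comment> \<open>Here 8192 originates: twice \<open>?H\<close> is
      \<open>4096 * K\<^sup>2 * w\<close>, and doubling once more absorbs
      \<open>w + 3\<close>.\<close>
    then have "w + 3 + 2 * ?H \<le> 8192 * K\<^sup>2 * w" using w1 by linarith
    then show "{ev \<in> EvA. card (lens ev) \<le> w + 3 + 2 * ?H} \<subseteq> {ev \<in> EvA. card (lens ev) \<le> 8192 * K\<^sup>2 * w}"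
      using le_trans by blast
  qed auto
  finally have "64 * K * p \<le> 64 * K * (2 * w * \<Sigma>)" by (rule mult_le_mono2)
  with 1 have "w * w * T \<le> 64 * K * (2 * w * \<Sigma>)" by (rule le_trans)
  moreover have "w * w * T = w * (w * T)" "64 * K * (2 * w * \<Sigma>) = w * (128 * K * \<Sigma>)" by simp_all
  ultimately have "w * (w * T) \<le> w * (128 * K * \<Sigma>)" by (simp only:)
  then have "w * T \<le> 128 * K * \<Sigma>" using w1 by (simp only: nat_mult_le_cancel1)
  then show ?thesis by (simp only: T_def \<Sigma>_def)
qed simp

text \<open>
  A lens of size \<open>s\<close> contributes \<open>s / w\<close> at each scale \<open>w\<close> that is not much smaller than \<open>s\<close>, a
  geometric series over dyadic scales. Hence the lenses cannot pay for all scales at once.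
\<close>

lemma card_touchings_le:
  fixes K :: nat
  assumes K: "K \<ge> 1" and XA: "card EvA \<le> K * card G" and XB: "card EvB \<le> K * card G"
  shows "card G \<le> 16 * K * 2 ^ (2097152 * K ^ 4 + 1) * card (fst ` G)"
proof (rule ccontr)
  define T where "T = card G"
  \<comment> \<open>One scale more than the lenses can pay for: they are worth at most
    \<open>32 * c * K * T = 2097152 * K ^ 4 * T\<close> in total, and every scale claims
    \<open>T\<close>.\<close>
  define R :: nat where "R = 2097152 * K ^ 4 + 1"
  \<comment> \<open>Chosen so that \<open>c * 2 ^ i\<close> is the size limit of
    \<open>scale_bound\<close> at the scale \<open>w = 8 * K * 2 ^ i\<close>.\<close>
  define c :: real where "c = 65536 * real K ^ 3"
  assume "\<not> ?thesis"
  then have big: "16 * K * 2 ^ R * card (fst ` G) < T" by (simp add: T_def R_def)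
  have c: "c > 0" using K by (simp add: c_def)
  have step: "real T \<le> (\<Sum>ev\<in>EvA. 16 * (if real (card (lens ev)) \<le> c * 2 ^ i then real (card (lens ev)) / 2 ^ i else 0))"
    if "i < R" for i
  proof -
    define w where "w = 8 * K * 2 ^ i"
    \<comment> \<open>The factor \<open>2 ^ R\<close> in the bound ensures that even the largest
      scale meets the density condition of \<open>scale_bound\<close>.\<close>
    have "(2 :: nat) ^ i \<le> 2 ^ R" using that by (intro power_increasing) auto
    then have "16 * K * 2 ^ i * card (fst ` G) \<le> 16 * K * 2 ^ R * card (fst ` G)"
      by (intro mult_le_mono) auto
    with big have "16 * K * 2 ^ i * card (fst ` G) \<le> card G" unfolding T_def by linarith
    moreover have "2 * w = 16 * K * 2 ^ i" by (simp add: w_def)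
    ultimately have "2 * w * card (fst ` G) \<le> card G" by (simp only:)
    moreover have "w \<ge> 8 * K" by (simp add: w_def)
    ultimately have "w * card G \<le> 128 * K * (\<Sum>ev\<in>{ev \<in> EvA. card (lens ev) \<le> 8192 * K\<^sup>2 * w}. card (lens ev))"
      using scale_bound K XA XB by blast
    then have "real (w * T) \<le> real (128 * K * (\<Sum>ev\<in>{ev \<in> EvA. card (lens ev) \<le> 8192 * K\<^sup>2 * w}. card (lens ev)))"
      unfolding T_def by (simp only: of_nat_le_iff)
    then have "8 * real K * (2 ^ i * real T) \<le> 8 * real K * (16 * (\<Sum>ev\<in>{ev \<in> EvA. card (lens ev) \<le> 8192 * K\<^sup>2 * w}. real (card (lens ev))))"
      by (simp add: w_def algebra_simps)
    then have "2 ^ i * real T \<le> 16 * (\<Sum>ev\<in>{ev \<in> EvA. card (lens ev) \<le> 8192 * K\<^sup>2 * w}. real (card (lens ev)))"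
      using K by (simp add: mult.commute)
    then have "real T \<le> 16 * (\<Sum>ev\<in>{ev \<in> EvA. card (lens ev) \<le> 8192 * K\<^sup>2 * w}. real (card (lens ev))) / 2 ^ i"
      by (simp add: field_simps)
    also have "\<dots> = (\<Sum>ev\<in>{ev \<in> EvA. card (lens ev) \<le> 8192 * K\<^sup>2 * w}. 16 * (real (card (lens ev)) / 2 ^ i))"
      by (simp add: sum_distrib_left sum_divide_distrib)
    also have "\<dots> = (\<Sum>ev\<in>EvA. if card (lens ev) \<le> 8192 * K\<^sup>2 * w then 16 * (real (card (lens ev)) / 2 ^ i) else 0)"
      by (rule sum.inter_filter[OF finite_EvA])
    also have "\<dots> = (\<Sum>ev\<in>EvA. 16 * (if real (card (lens ev)) \<le> c * 2 ^ i then real (card (lens ev)) / 2 ^ i else 0))"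
    proof (rule sum.cong[OF refl])
      fix ev
      have cw: "c * 2 ^ i = real (8192 * K\<^sup>2 * w)"
        by (simp add: c_def w_def power2_eq_square power3_eq_cube)
      show "(if card (lens ev) \<le> 8192 * K\<^sup>2 * w then 16 * (real (card (lens ev)) / 2 ^ i) else 0)
        = 16 * (if real (card (lens ev)) \<le> c * 2 ^ i then real (card (lens ev)) / 2 ^ i else 0)"
        unfolding cw of_nat_le_iff by simp
    qed
    finally show ?thesis .
  qed
  have "real R * real T = (\<Sum>i<R. real T)" by simp
  also have "\<dots> \<le> (\<Sum>i<R. \<Sum>ev\<in>EvA. 16 * (if real (card (lens ev)) \<le> c * 2 ^ i then real (card (lens ev)) / 2 ^ i else 0))"
    using step by (intro sum_mono) auto
  also have "\<dots> = (\<Sum>ev\<in>EvA. 16 * (\<Sum>i<R. if real (card (lens ev)) \<le> c * 2 ^ i then real (card (lens ev)) / 2 ^ i else 0))"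
    by (subst sum.swap) (simp add: sum_distrib_left)
  also have "\<dots> \<le> (\<Sum>ev\<in>EvA. 32 * c)"
  proof (rule sum_mono)
    fix ev
    show "16 * (\<Sum>i<R. if real (card (lens ev)) \<le> c * 2 ^ i then real (card (lens ev)) / 2 ^ i else 0) \<le> 32 * c"
      using sum_dyadic_truncated_le[OF c, of "real (card (lens ev))" R] by (simp add: min_def split: if_splits)
  qed
  also have "\<dots> = 32 * c * real (card EvA)" by simp
  also have "\<dots> \<le> 32 * c * (real K * real T)"
    using XA c unfolding T_def by (intro mult_left_mono) (simp_all flip: of_nat_mult)
  also have "\<dots> = (2097152 * real K ^ 4) * real T"
    by (simp add: c_def power_numeral_reduce)
  also have "\<dots> = (real R - 1) * real T" by (simp add: R_def)
  finally have "real T \<le> 0" by (simp add: algebra_simps)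
  with big show False by simp
qed

end

section \<open>Touching arcs of closed curves\<close>

definition graph_on :: "real \<Rightarrow> real \<Rightarrow> (real \<Rightarrow> real) \<Rightarrow> complex set" where
  "graph_on l r f = (\<lambda>t. Complex t (f t)) ` {l..r}"

lemma mem_graph_on: "z \<in> graph_on l r f \<longleftrightarrow> l \<le> Re z \<and> Re z \<le> r \<and> Im z = f (Re z)"
  by (force simp: graph_on_def complex_eq_iff)

text \<open>On the compact arc \<open>A\<close> the injective map \<open>Re\<close> is a
  homeomorphism onto a compact connected set of reals, hence an interval; \<open>f\<close> is the
  imaginary part of the inverse.\<close>

lemma x_monotone_graph:
  assumes "x_monotone A"
  obtains l r f where "continuous_on {l..r} f" "A = graph_on l r f"
proof -
  from assms obtain g where g: "arc g" "path_image g = A" and inj: "inj_on Re A"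
    by (auto simp: x_monotone_def open_curve_def)
  have A: "compact A" "connected A"
    using g by (metis arc_imp_path compact_path_image connected_path_image)+
  have cont: "continuous_on A Re" by (intro continuous_intros)
  obtain h where h: "homeomorphism A (Re ` A) Re h"
    using homeomorphism_compact[OF A(1) cont refl inj] by blast
  have "compact (Re ` A)" "connected (Re ` A)"
    using A cont by (auto intro: compact_continuous_image connected_continuous_image)
  then obtain l r where lr: "Re ` A = {l..r}" by (metis connected_compact_interval_1)
  have "continuous_on {l..r} (\<lambda>t. Im (h t))"
    using h lr by (intro continuous_intros) (auto simp: homeomorphism_def)
  moreover have "A = graph_on l r (\<lambda>t. Im (h t))"
  proof (intro set_eqI iffI)
    fix z assume z: "z \<in> A"
    then have "h (Re z) = z" using h by (auto simp: homeomorphism_def)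
    moreover have "Re z \<in> {l..r}" using z lr by blast
    ultimately show "z \<in> graph_on l r (\<lambda>t. Im (h t))" by (simp add: mem_graph_on)
  next
    fix z assume z: "z \<in> graph_on l r (\<lambda>t. Im (h t))"
    then have R: "Re z \<in> Re ` A" and I: "Im z = Im (h (Re z))" by (auto simp: mem_graph_on lr)
    have "h (Re z) \<in> A" "Re (h (Re z)) = Re z" using h R by (auto simp: homeomorphism_def)
    moreover have "z = h (Re z)" using I calculation(2) by (simp add: complex_eq_iff)
    ultimately show "z \<in> A" by simp
  qed
  ultimately show ?thesis by (rule that)
qed

section \<open>Closed curves near an arc that is a graph\<close>

lemma closed_curve_based:
  assumes "closed_curve C" "q \<in> C"
  obtains g where "simple_path g" "pathstart g = q" "pathfinish g = q" "path_image g = C"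
proof -
  from assms(1) obtain g where g: "simple_path g" "pathfinish g = pathstart g" "path_image g = C"
    by (auto simp: closed_curve_def)
  obtain a where a: "a \<in> {0..1}" "q = g a" using assms(2) g(3) by (auto simp: path_image_def)
  show ?thesis
  proof (rule that[of "shiftpath a g"])
    show "simple_path (shiftpath a g)" using simple_path_shiftpath g a by auto
    show "pathstart (shiftpath a g) = q" using a by (simp add: pathstart_shiftpath)
    show "pathfinish (shiftpath a g) = q" using a g by (simp add: pathfinish_shiftpath)
    show "path_image (shiftpath a g) = C" using path_image_shiftpath a g by auto
  qed
qed

lemma connected_closed_curve_minus_point:
  assumes "closed_curve C" "q \<in> C"
  shows "connected (C - {q})"
proof -
  obtain g where "simple_path g" "pathstart g = q" "pathfinish g = q" "path_image g = C"
    using closed_curve_based[OF assms] .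
  then show ?thesis using connected_simple_path_endless[of g] by simp
qed

text \<open>By invariance of domain in dimension one, the graph occupies an open set of parameters
  around that of the given point. The remaining parameters form a compact set, whose image stays
  away from the point.\<close>

lemma closed_curve_locally_graph:
  assumes C: "closed_curve C" and f: "continuous_on {l..r} f" and sub: "graph_on l r f \<subseteq> C"
    and t0: "l < t0" "t0 < r"
  obtains \<rho> where "\<rho> > 0" "ball (Complex t0 (f t0)) \<rho> \<inter> C \<subseteq> graph_on l r f"
proof -
  \<comment> \<open>The curve is based at the left end of the arc. The part over
    \<open>{s..r}\<close> avoids this base point, so its parameters lie in the open unit interval,
    where \<open>g\<close> is injective.\<close>
  define q where "q = Complex l (f l)"
  define p where "p = Complex t0 (f t0)"
  define s where "s = (l + t0) / 2"
  have s: "l < s" "s < t0" using t0 by (auto simp: s_def)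
  let ?\<gamma> = "\<lambda>t. Complex t (f t)"
  have "q \<in> C" using sub t0 by (auto simp: q_def mem_graph_on)
  then obtain g where g: "simple_path g" "pathstart g = q" "pathfinish g = q" "path_image g = C"
    using closed_curve_based[OF C] by blast
  have contg: "continuous_on {0..1} g" using g(1) by (simp add: simple_path_def path_def)
  have ends: "g 0 = q" "g 1 = q" using g by (auto simp: pathstart_def pathfinish_def)
  have injg: "u = v" if "u \<in> {0<..<1}" "v \<in> {0..1}" "g u = g v" for u v
    using g(1) that unfolding simple_path_def loop_free_def by force
  define \<alpha> where "\<alpha> = graph_on s r f"
  have cont\<gamma>: "continuous_on {s..r} ?\<gamma>"
  proof -
    have "continuous_on {s..r} f" using f s by (rule_tac continuous_on_subset) auto
    then show ?thesis unfolding Complex_eq by (intro continuous_intros)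
  qed
  have \<alpha>: "compact \<alpha>" unfolding \<alpha>_def graph_on_def by (rule compact_continuous_image[OF cont\<gamma>]) simp
  have q\<alpha>: "q \<notin> \<alpha>" using s by (auto simp: \<alpha>_def q_def mem_graph_on)
  have \<alpha>C: "\<alpha> \<subseteq> C" using sub s by (auto simp: \<alpha>_def mem_graph_on)
  define Z where "Z = {0..1} \<inter> g -` \<alpha>"
  have "closed Z" unfolding Z_def
    using continuous_closed_preimage[OF contg closed_real_atLeastAtMost] \<alpha> compact_imp_closed by blast
  then have Zc: "compact Z" by (metis Z_def compact_Icc compact_Int_closed inf.idem inf_sup_aci(4) inf_assoc)
  have Z01: "Z \<subseteq> {0<..<1}" using q\<alpha> ends by (force simp: Z_def less_le)
  have gZ: "g ` Z = \<alpha>" using \<alpha>C g(4) by (force simp: Z_def path_image_def)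
  have "inj_on g Z" using injg Z01 by (meson inj_onI greaterThanLessThan_subseteq_atLeastAtMost_iff order_refl subsetD)
  moreover have "continuous_on Z g" using contg by (rule continuous_on_subset) (auto simp: Z_def)
  ultimately obtain k where k: "homeomorphism Z \<alpha> g k" using homeomorphism_compact[OF Zc _ gZ] by blast
  define h where "h = k \<circ> ?\<gamma>"
  have \<gamma>\<alpha>: "?\<gamma> ` {s..r} = \<alpha>" by (simp add: \<alpha>_def graph_on_def)
  have gh: "g (h t) = ?\<gamma> t" "h t \<in> Z" if "t \<in> {s..r}" for t
    using k that \<gamma>\<alpha> unfolding h_def homeomorphism_def by auto
  have conth: "continuous_on {s..r} h" unfolding h_def
    using k cont\<gamma> \<gamma>\<alpha> by (intro continuous_on_compose) (auto simp: homeomorphism_def)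
  have injh: "inj_on h {s..r}"
    by (rule inj_onI) (metis complex.sel(1) gh(1))
  have opn: "open (h ` {s<..<r})"
    by (rule injective_into_1d_imp_open_map_UNIV[OF _ conth injh]) auto
  define W where "W = g ` ({0..1} - h ` {s<..<r})"
  have "compact W" unfolding W_def
    using opn contg by (intro compact_continuous_image) (auto intro: continuous_on_subset compact_diff)
  then have "open (- W)" by (simp add: compact_imp_closed open_Compl)
  moreover have "p \<notin> W"
  proof
    assume "p \<in> W"
    then obtain v where v: "v \<in> {0..1}" "v \<notin> h ` {s<..<r}" "g v = p" by (auto simp: W_def)
    have "t0 \<in> {s..r}" "t0 \<in> {s<..<r}" using s t0 by auto
    then have "g (h t0) = g v" "h t0 \<in> {0<..<1}" using gh[of t0] v Z01 by (auto simp: p_def)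
    then have "h t0 = v" using injg v(1) by blast
    then show False using v(2) \<open>t0 \<in> {s<..<r}\<close> by blast
  qed
  ultimately obtain \<rho> where \<rho>: "\<rho> > 0" "ball p \<rho> \<subseteq> - W" by (meson ComplI open_contains_ball)
  have "ball p \<rho> \<inter> C \<subseteq> graph_on l r f"
  proof
    fix z assume z: "z \<in> ball p \<rho> \<inter> C"
    then obtain v where v: "v \<in> {0..1}" "g v = z" using g(4) by (auto simp: path_image_def)
    have "z \<notin> W" using z \<rho> by auto
    then have "v \<in> h ` {s<..<r}" using v by (auto simp: W_def)
    then obtain t where "t \<in> {s<..<r}" "v = h t" by auto
    then have "z = ?\<gamma> t" "t \<in> {l..r}" using gh(1)[of t] v s by auto
    then show "z \<in> graph_on l r f" by (simp add: mem_graph_on)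
  qed
  with \<rho>(1) show ?thesis unfolding p_def by (rule that)
qed

text \<open>In a small box around the point the curve is just the graph, so the parts of the box
  above and below are connected and miss \<open>C\<close>, and each lies in one component of the
  complement. They lie in different ones because the point is on the frontier of both. Which of
  \<open>I\<close> and \<open>J\<close> is the inside is left open.\<close>

lemma closed_curve_sides:
  assumes C: "closed_curve C" and f: "continuous_on {l..r} f" and sub: "graph_on l r f \<subseteq> C"
    and t0: "l < t0" "t0 < r"
  obtains \<eta> \<zeta> I J where "\<eta> > 0" "\<zeta> > 0" "open I" "open J" "I \<inter> J = {}" "- C \<subseteq> I \<union> J"
    "\<And>z. \<bar>Re z - t0\<bar> < \<eta> \<Longrightarrow> \<bar>Im z - f t0\<bar> < \<zeta> \<Longrightarrow> f (Re z) < Im z \<Longrightarrow> z \<in> I"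
    "\<And>z. \<bar>Re z - t0\<bar> < \<eta> \<Longrightarrow> \<bar>Im z - f t0\<bar> < \<zeta> \<Longrightarrow> Im z < f (Re z) \<Longrightarrow> z \<in> J"
proof -
  define p where "p = Complex t0 (f t0)"
  obtain g where g: "simple_path g" "pathfinish g = pathstart g" "path_image g = C"
    using C by (auto simp: closed_curve_def)
  have op: "open (inside C)" "open (outside C)" and fr: "frontier (inside C) = C" "frontier (outside C) = C"
    using Jordan_inside_outside[OF g(1,2)] g(3) by auto
  have io: "inside C \<inter> outside C = {}" "- C = inside C \<union> outside C"
    using inside_Int_outside inside_Un_outside by auto
  have pC: "p \<in> C" using sub t0 by (auto simp: p_def mem_graph_on)
  obtain \<rho> where \<rho>: "\<rho> > 0" "ball p \<rho> \<inter> C \<subseteq> graph_on l r f"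
    unfolding p_def by (rule closed_curve_locally_graph[OF C f sub t0])
  define \<zeta> where "\<zeta> = \<rho> / 2"
  have \<zeta>: "\<zeta> > 0" using \<rho> by (simp add: \<zeta>_def)
  have "continuous (at t0) f" using continuous_on_interior[OF f] t0 by simp
  then obtain d where d: "d > 0" "\<And>t. \<bar>t - t0\<bar> < d \<Longrightarrow> \<bar>f t - f t0\<bar> < \<zeta>"
    using \<zeta> unfolding continuous_at_eps_delta by (auto simp: dist_real_def)
  define \<eta> where "\<eta> = min (min d \<zeta>) (min (t0 - l) (r - t0))"
  have \<eta>: "\<eta> > 0" using d \<zeta> t0 by (simp add: \<eta>_def)
  define B where "B = {z. \<bar>Re z - t0\<bar> < \<eta> \<and> \<bar>Im z - f t0\<bar> < \<zeta>}"
  define U where "U = {z \<in> B. f (Re z) < Im z}"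
  define D where "D = {z \<in> B. Im z < f (Re z)}"
  have B_ball: "B \<subseteq> ball p \<rho>"
  proof
    fix z assume z: "z \<in> B"
    have "dist p z = cmod (z - p)" by (simp add: dist_norm norm_minus_commute)
    also have "\<dots> \<le> \<bar>Re (z - p)\<bar> + \<bar>Im (z - p)\<bar>" by (rule cmod_le)
    also have "\<dots> < \<zeta> + \<zeta>" using z by (auto simp: B_def p_def \<eta>_def)
    finally show "z \<in> ball p \<rho>" by (simp add: \<zeta>_def)
  qed
  have UD: "(U \<union> D) \<inter> C = {}"
    using B_ball \<rho>(2) by (fastforce simp: U_def D_def mem_graph_on)
  have BC: "B \<subseteq> U \<union> D \<union> C"
  proof
    fix z assume z: "z \<in> B"
    then have "l \<le> Re z" "Re z \<le> r" by (auto simp: B_def \<eta>_def)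
    then have "z \<in> C" if "Im z = f (Re z)" using that sub by (auto simp: mem_graph_on)
    then show "z \<in> U \<union> D \<union> C" using z by (fastforce simp: U_def D_def)
  qed
  have contf: "continuous_on {t0 - \<eta><..<t0 + \<eta>} f"
    using f by (rule continuous_on_subset) (auto simp: \<eta>_def)
  have fB: "\<bar>f t - f t0\<bar> < \<zeta>" if "\<bar>t - t0\<bar> < \<eta>" for t using that d(2) by (auto simp: \<eta>_def)
  let ?R = "{t0 - \<eta><..<t0 + \<eta>} \<times> {0<..<1 :: real}"
  have conR: "connected ?R" by (intro convex_connected convex_Times) auto
  have contfst: "continuous_on ?R (\<lambda>z. f (fst z))"
    by (rule continuous_on_compose2[OF contf continuous_on_fst[OF continuous_on_id]]) auto
  have conU: "connected U"
  proof -
    \<comment> \<open>The region is swept by vertical segments from the graph to the top edge of the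
      box, hence is a continuous image of a rectangle.\<close>
    let ?m = "\<lambda>z. Complex (fst z) (f (fst z) + snd z * (f t0 + \<zeta> - f (fst z)))"
    have cont: "continuous_on ?R ?m" unfolding Complex_eq by (intro continuous_intros contfst)
    have img: "?m ` ?R = U"
    proof (intro set_eqI iffI)
      fix z assume "z \<in> ?m ` ?R"
      then obtain t s where ts: "\<bar>t - t0\<bar> < \<eta>" "0 < s" "s < 1" "z = Complex t (f t + s * (f t0 + \<zeta> - f t))"
        by auto
      have pos: "0 < f t0 + \<zeta> - f t" using fB[OF ts(1)] by auto
      define y where "y = s * (f t0 + \<zeta> - f t)"
      have y: "0 < y" "y < 1 * (f t0 + \<zeta> - f t)"
        unfolding y_def by (rule mult_pos_pos[OF ts(2) pos], rule mult_strict_right_mono[OF ts(3) pos])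
      have "\<bar>f t + y - f t0\<bar> < \<zeta>" using y fB[OF ts(1)] by (auto simp: abs_less_iff)
      then show "z \<in> U" using ts(1) y by (simp add: U_def B_def ts(4) flip: y_def)
    next
      fix z assume z: "z \<in> U"
      then have zz: "\<bar>Re z - t0\<bar> < \<eta>" "\<bar>Im z - f t0\<bar> < \<zeta>" "f (Re z) < Im z" by (auto simp: U_def B_def)
      let ?s = "(Im z - f (Re z)) / (f t0 + \<zeta> - f (Re z))"
      have pos: "f t0 + \<zeta> - f (Re z) > 0" using fB[OF zz(1)] by auto
      then have "0 < ?s" "?s < 1" "z = ?m (Re z, ?s)"
        using zz by (auto simp: complex_eq_iff)
      then show "z \<in> ?m ` ?R" using zz by (intro image_eqI[of _ _ "(Re z, ?s)"]) auto
    qed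
    show ?thesis using connected_continuous_image[OF cont conR] unfolding img .
  qed
  have conD: "connected D"
  proof -
    let ?m = "\<lambda>z. Complex (fst z) (f (fst z) - snd z * (f (fst z) - f t0 + \<zeta>))"
    have cont: "continuous_on ?R ?m" unfolding Complex_eq by (intro continuous_intros contfst)
    have img: "?m ` ?R = D"
    proof (intro set_eqI iffI)
      fix z assume "z \<in> ?m ` ?R"
      then obtain t s where ts: "\<bar>t - t0\<bar> < \<eta>" "0 < s" "s < 1" "z = Complex t (f t - s * (f t - f t0 + \<zeta>))"
        by auto
      have pos: "0 < f t - f t0 + \<zeta>" using fB[OF ts(1)] by auto
      define y where "y = s * (f t - f t0 + \<zeta>)"
      have y: "0 < y" "y < 1 * (f t - f t0 + \<zeta>)"
        unfolding y_def by (rule mult_pos_pos[OF ts(2) pos], rule mult_strict_right_mono[OF ts(3) pos])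
      have "\<bar>f t - y - f t0\<bar> < \<zeta>" using y fB[OF ts(1)] by (auto simp: abs_less_iff)
      then show "z \<in> D" using ts(1) y by (simp add: D_def B_def ts(4) flip: y_def)
    next
      fix z assume z: "z \<in> D"
      then have zz: "\<bar>Re z - t0\<bar> < \<eta>" "\<bar>Im z - f t0\<bar> < \<zeta>" "Im z < f (Re z)" by (auto simp: D_def B_def)
      let ?s = "(f (Re z) - Im z) / (f (Re z) - f t0 + \<zeta>)"
      have pos: "f (Re z) - f t0 + \<zeta> > 0" using fB[OF zz(1)] by auto
      then have "0 < ?s" "?s < 1" "z = ?m (Re z, ?s)"
        using zz by (auto simp: complex_eq_iff)
      then show "z \<in> ?m ` ?R" using zz by (intro image_eqI[of _ _ "(Re z, ?s)"]) auto
    qed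
    show ?thesis using connected_continuous_image[OF cont conR] unfolding img .
  qed
  have side: "S \<subseteq> inside C \<or> S \<subseteq> outside C" if "connected S" "S \<inter> C = {}" for S
  proof -
    have "S \<subseteq> inside C \<union> outside C" using that(2) io(2) by blast
    then show ?thesis using connectedD[OF that(1) op] io(1) by blast
  qed
  have openB: "open B"
  proof -
    have "B = Re -` {t0 - \<eta><..<t0 + \<eta>} \<inter> Im -` {f t0 - \<zeta><..<f t0 + \<zeta>}"
      by (auto simp: B_def)
    then show ?thesis
      by (auto intro!: open_Int continuous_open_vimage continuous_intros)
  qed
  have pB: "p \<in> B" using \<eta> \<zeta> by (simp add: B_def p_def)
  have meets: "inside C \<inter> (U \<union> D) \<noteq> {}" "outside C \<inter> (U \<union> D) \<noteq> {}"
  proof -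
    have "p \<in> closure (inside C)" "p \<in> closure (outside C)"
      using pC fr unfolding frontier_def by blast+
    then have "inside C \<inter> B \<noteq> {}" "outside C \<inter> B \<noteq> {}"
      using openB pB by (auto simp: closure_iff_nhds_not_empty Int_commute)
    then show "inside C \<inter> (U \<union> D) \<noteq> {}" "outside C \<inter> (U \<union> D) \<noteq> {}"
      using BC io inside_no_overlap outside_no_overlap by blast+
  qed
  have "U \<inter> C = {}" "D \<inter> C = {}" using UD by auto
  then consider "U \<subseteq> inside C" "D \<subseteq> outside C" | "U \<subseteq> outside C" "D \<subseteq> inside C"
    using side[OF conU] side[OF conD] meets io by blast
  then show ?thesis
  proof cases
    case 1
    have "inside C \<inter> outside C = {}" "- C \<subseteq> inside C \<union> outside C" using io by blast+
    then show ?thesis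
      by (rule that[OF \<eta> \<zeta> op]) (use 1 in \<open>auto simp: U_def D_def B_def\<close>)
  next
    case 2
    have "outside C \<inter> inside C = {}" "- C \<subseteq> outside C \<union> inside C" using io by blast+
    then show ?thesis
      by (rule that[OF \<eta> \<zeta> op(2,1)]) (use 2 in \<open>auto simp: U_def D_def B_def\<close>)
  qed
qed

section \<open>Arcs of two curves with a single common point\<close>

lemma constant_sign_on_interval:
  fixes h :: "real \<Rightarrow> real"
  assumes "connected S" "continuous_on S h" "\<And>t. t \<in> S \<Longrightarrow> h t \<noteq> 0"
  shows "(\<forall>t\<in>S. h t > 0) \<or> (\<forall>t\<in>S. h t < 0)"
proof (rule ccontr)
  assume "\<not> ?thesis"
  then obtain u v where uv: "u \<in> S" "v \<in> S" "h u < 0" "h v > 0"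
    using assms(3) by (meson linorder_neqE_linordered_idom)
  have "is_interval (h ` S)"
    using connected_continuous_image[OF assms(2,1)] by (simp only: is_interval_connected_1)
  from mem_is_interval_1_I[OF this imageI[OF uv(1)] imageI[OF uv(2)] less_imp_le[OF uv(3)] less_imp_le[OF uv(4)]]
  have "0 \<in> h ` S" .
  then obtain t where "t \<in> S" "0 = h t" by (rule imageE)
  then show False using assms(3)[of t] by simp
qed

text \<open>Removing \<open>p\<close> leaves \<open>C'\<close> connected and disjoint from
  \<open>C\<close>, yet it would have a point below the graph of \<open>f\<close> just left of
  \<open>p\<close> and one above it just right of \<open>p\<close>, hence points on both sides of
  \<open>C\<close>.\<close>

lemma touching_graphs_not_crossing:
  assumes C: "closed_curve C" and C': "closed_curve C'" and p: "C \<inter> C' = {p}"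
    and f: "continuous_on {l..r} f" and sub: "graph_on l r f \<subseteq> C"
    and f': "continuous_on {l'..r'} f'" and sub': "graph_on l' r' f' \<subseteq> C'"
    and pf: "p \<in> graph_on l r f" and pf': "p \<in> graph_on l' r' f'"
    and l: "l < Re p" "l' < Re p" and r: "Re p < r" "Re p < r'"
    and below: "\<And>t. max l l' \<le> t \<Longrightarrow> t < Re p \<Longrightarrow> f' t < f t"
    and above: "\<And>t. Re p < t \<Longrightarrow> t \<le> min r r' \<Longrightarrow> f t < f' t"
  shows False
proof -
  define t0 where "t0 = Re p"
  have p0: "f t0 = Im p" "f' t0 = Im p" using pf pf' by (auto simp: mem_graph_on t0_def)
  obtain \<eta> \<zeta> I J where s: "\<eta> > 0" "\<zeta> > 0" "open I" "open J" "I \<inter> J = {}" "- C \<subseteq> I \<union> J"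
    and I: "\<And>z. \<bar>Re z - t0\<bar> < \<eta> \<Longrightarrow> \<bar>Im z - f t0\<bar> < \<zeta> \<Longrightarrow> f (Re z) < Im z \<Longrightarrow> z \<in> I"
    and J: "\<And>z. \<bar>Re z - t0\<bar> < \<eta> \<Longrightarrow> \<bar>Im z - f t0\<bar> < \<zeta> \<Longrightarrow> Im z < f (Re z) \<Longrightarrow> z \<in> J"
    using closed_curve_sides[OF C f sub l(1) r(1)] unfolding t0_def by metis
  have "continuous (at t0) f'" using continuous_on_interior[OF f'] l r by (simp add: t0_def)
  then obtain d where d: "d > 0" "\<And>t. \<bar>t - t0\<bar> < d \<Longrightarrow> \<bar>f' t - f' t0\<bar> < \<zeta>"
    using s(2) unfolding continuous_at_eps_delta by (auto simp: dist_real_def)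
  define \<mu> where "\<mu> = min (min d \<eta>) (min (min (t0 - l) (t0 - l')) (min (r - t0) (r' - t0))) / 2"
  have \<mu>: "\<mu> > 0" "\<mu> < d" "\<mu> < \<eta>" "max l l' \<le> t0 - \<mu>" "t0 + \<mu> \<le> min r r'"
    using d s l r by (auto simp: \<mu>_def t0_def min_def max_def field_simps)
  let ?u = "Complex (t0 - \<mu>) (f' (t0 - \<mu>))" and ?v = "Complex (t0 + \<mu>) (f' (t0 + \<mu>))"
  have "?u \<in> J" using \<mu> d(2)[of "t0 - \<mu>"] below[of "t0 - \<mu>"] p0 by (intro J) (auto simp: t0_def)
  moreover have "?v \<in> I" using \<mu> d(2)[of "t0 + \<mu>"] above[of "t0 + \<mu>"] p0 by (intro I) (auto simp: t0_def)
  moreover have "?u \<in> C' - {p}" "?v \<in> C' - {p}"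
    using sub' \<mu> by (auto simp: mem_graph_on t0_def complex_eq_iff subset_iff)
  moreover have "connected (C' - {p})"
    using connected_closed_curve_minus_point[OF C'] p by blast
  moreover have "C' - {p} \<subseteq> I \<union> J" using p s(6) by blast
  ultimately show False using s(3-5) connectedD[of "C' - {p}" I J] by blast
qed

text \<open>Away from \<open>p\<close> the difference \<open>f' - f\<close> has no zero, so its sign
  is constant on each side of \<open>p\<close>, and opposite signs would be a crossing. If
  \<open>p\<close> ends the common range, one side is empty and there is nothing to exclude.\<close>

lemma touching_graphs_comparable:
  assumes C: "closed_curve C" and C': "closed_curve C'" and p: "C \<inter> C' = {p}"
    and f: "continuous_on {l..r} f" and sub: "graph_on l r f \<subseteq> C"
    and f': "continuous_on {l'..r'} f'" and sub': "graph_on l' r' f' \<subseteq> C'"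
    and pf: "p \<in> graph_on l r f" and pf': "p \<in> graph_on l' r' f'"
  shows "(\<forall>t\<in>{l..r} \<inter> {l'..r'}. f t \<le> f' t) \<or> (\<forall>t\<in>{l..r} \<inter> {l'..r'}. f' t \<le> f t)"
proof -
  let ?S = "{max l l'..<Re p}" and ?T = "{Re p<..min r r'}"
  have p0: "f (Re p) = Im p" "f' (Re p) = Im p" "l \<le> Re p" "l' \<le> Re p" "Re p \<le> r" "Re p \<le> r'"
    using pf pf' by (auto simp: mem_graph_on)
  have ne: "f' t - f t \<noteq> 0" if "t \<in> {l..r}" "t \<in> {l'..r'}" "t \<noteq> Re p" for t
  proof
    assume "f' t - f t = 0"
    then have "Complex t (f t) \<in> C \<inter> C'" using that sub sub' by (auto simp: mem_graph_on subset_iff)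
    then show False using p that by auto
  qed
  have cont: "continuous_on ({l..r} \<inter> {l'..r'}) (\<lambda>t. f' t - f t)"
    by (intro continuous_intros continuous_on_subset[OF f] continuous_on_subset[OF f']) auto
  have signS: "(\<forall>t\<in>?S. f' t - f t > 0) \<or> (\<forall>t\<in>?S. f' t - f t < 0)"
    using p0 ne by (intro constant_sign_on_interval continuous_on_subset[OF cont]) auto
  have signT: "(\<forall>t\<in>?T. f' t - f t > 0) \<or> (\<forall>t\<in>?T. f' t - f t < 0)"
    using p0 ne by (intro constant_sign_on_interval continuous_on_subset[OF cont]) auto
  have cover: "t \<in> ?S \<or> t = Re p \<or> t \<in> ?T" if "t \<in> {l..r} \<inter> {l'..r'}" for t
    using that by auto
  have same: "?thesis" if "(\<forall>t\<in>?S \<union> ?T. f' t - f t > 0) \<or> (\<forall>t\<in>?S \<union> ?T. f' t - f t < 0)"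
    using that
  proof
    assume *: "\<forall>t\<in>?S \<union> ?T. f' t - f t > 0"
    have "f t \<le> f' t" if "t \<in> {l..r} \<inter> {l'..r'}" for t
    proof (cases "t = Re p")
      case False
      then have "t \<in> ?S \<union> ?T" using cover[OF that] by blast
      with * have "f' t - f t > 0" by (rule bspec)
      then show ?thesis by simp
    qed (simp add: p0)
    then show ?thesis by blast
  next
    assume *: "\<forall>t\<in>?S \<union> ?T. f' t - f t < 0"
    have "f' t \<le> f t" if "t \<in> {l..r} \<inter> {l'..r'}" for t
    proof (cases "t = Re p")
      case False
      then have "t \<in> ?S \<union> ?T" using cover[OF that] by blast
      with * have "f' t - f t < 0" by (rule bspec)
      then show ?thesis by simp
    qed (simp add: p0)
    then show ?thesis by blast
  qed
  show ?thesis
  proof (cases "?S = {} \<or> ?T = {}")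
    case True
    then show ?thesis using signS signT by (intro same) blast
  next
    case False
    then have int: "l < Re p" "l' < Re p" "Re p < r" "Re p < r'" by auto
    have n1: "\<not> ((\<forall>t\<in>?S. f' t - f t < 0) \<and> (\<forall>t\<in>?T. f' t - f t > 0))"
    proof
      assume *: "(\<forall>t\<in>?S. f' t - f t < 0) \<and> (\<forall>t\<in>?T. f' t - f t > 0)"
      show False
        by (rule touching_graphs_not_crossing[OF C C' p f sub f' sub' pf pf' int]) (use * in simp_all)
    qed
    have p': "C' \<inter> C = {p}" using p by auto
    \<comment> \<open>The other crossing pattern is the first one with the two curves
      exchanged.\<close>
    have n2: "\<not> ((\<forall>t\<in>?S. f' t - f t > 0) \<and> (\<forall>t\<in>?T. f' t - f t < 0))"
    proof
      assume *: "(\<forall>t\<in>?S. f' t - f t > 0) \<and> (\<forall>t\<in>?T. f' t - f t < 0)"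
      show False
        by (rule touching_graphs_not_crossing[OF C' C p' f' sub' f sub pf' pf int(2,1,4,3)]) (use * in simp_all)
    qed
    show ?thesis using signS signT n1 n2 by (intro same) blast
  qed
qed

section \<open>Counting intersection points\<close>

text \<open>If \<open>g\<close> and \<open>g'\<close> are both defined on \<open>{t..t'}\<close>,
  then \<open>g\<close> is the lower one at \<open>t\<close>, where it meets \<open>f\<close>, and
  \<open>g'\<close> at \<open>t'\<close>, so they swap by the intermediate value theorem. Otherwise
  \<open>g'\<close> starts after \<open>t\<close> or \<open>g\<close> ends before \<open>t'\<close>,
  and that end serves as the event.\<close>

lemma touching_from_below_separated:
  fixes f g g' :: "real \<Rightarrow> real"
  assumes contg: "continuous_on {l..r} g" and contg': "continuous_on {l'..r'} g'"
    and t: "t \<in> {u..v}" "t \<in> {l..r}" "f t = g t"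
    and t': "t' \<in> {u..v}" "t' \<in> {l'..r'}" "f t' = g' t'"
    and le: "\<And>s. s \<in> {u..v} \<inter> {l..r} \<Longrightarrow> f s \<le> g s"
    and le': "\<And>s. s \<in> {u..v} \<inter> {l'..r'} \<Longrightarrow> f s \<le> g' s"
    and ne: "t \<in> {l'..r'} \<Longrightarrow> g' t \<noteq> g t" and ne': "t' \<in> {l..r} \<Longrightarrow> g t' \<noteq> g' t'"
    and eps: "\<epsilon> > 0" "t < l' \<Longrightarrow> t < l' - \<epsilon>" "r < t' \<Longrightarrow> r + \<epsilon> < t'"
    and tt: "t < t'"
  shows "\<exists>e. t < e \<and> e < t' \<and> (e = l' - \<epsilon> \<or> e = r + \<epsilon> \<or> e \<in> {l..r} \<inter> {l'..r'} \<and> g e = g' e)"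
proof -
  consider "t < l'" | "r < t'" | "l' \<le> t" "t' \<le> r" by linarith
  then show ?thesis
  proof cases
    case 1
    then show ?thesis using eps t' by (intro exI[of _ "l' - \<epsilon>"]) auto
  next
    case 2
    then show ?thesis using eps t by (intro exI[of _ "r + \<epsilon>"]) auto
  next
    case 3
    have dom: "{t..t'} \<subseteq> {l..r}" "{t..t'} \<subseteq> {l'..r'}" using 3 t t' by auto
    have "g t < g' t" using le'[of t] ne t t' 3 tt by force
    moreover have "g' t' < g t'" using le[of t'] ne' t t' 3 tt by force
    moreover have "continuous_on {t..t'} (\<lambda>s. g' s - g s)"
      by (intro continuous_intros continuous_on_subset[OF contg dom(1)] continuous_on_subset[OF contg' dom(2)])
    ultimately obtain e where e: "t \<le> e" "e \<le> t'" "g' e - g e = 0"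
      using IVT2'[of "\<lambda>s. g' s - g s" t' 0 t] tt by auto
    moreover have "e \<noteq> t" "e \<noteq> t'" using e \<open>g t < g' t\<close> \<open>g' t' < g t'\<close> by auto
    ultimately show ?thesis using dom by (intro exI[of _ e]) auto
  qed
qed

lemma finite_set_gap:
  fixes V :: "real set"
  assumes "finite V"
  obtains \<epsilon> where "\<epsilon> > 0" "\<And>u v. u \<in> V \<Longrightarrow> v \<in> V \<Longrightarrow> u < v \<Longrightarrow> u + \<epsilon> < v"
proof -
  define W where "W = insert 1 ((\<lambda>(u, v). v - u) ` {(u, v). u \<in> V \<and> v \<in> V \<and> u < v})"
  have "finite {(u, v). u \<in> V \<and> v \<in> V \<and> u < v}"
    by (rule finite_subset[of _ "V \<times> V"]) (use assms in auto)
  then have W: "finite W" "W \<noteq> {}" "\<forall>w\<in>W. w > 0" by (auto simp: W_def)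
  show ?thesis
  proof (rule that[of "Min W / 2"])
    show "Min W / 2 > 0" using Min_in[OF W(1,2)] W(3) by simp
    fix u v assume uv: "u \<in> V" "v \<in> V" "u < v"
    then have "v - u \<in> W" by (force simp: W_def)
    then have "Min W \<le> v - u" "Min W > 0" using W Min_in[OF W(1,2)] by auto
    then show "u + Min W / 2 < v" by linarith
  qed
qed

section \<open>The touching system of a family of curves\<close>

definition meetings :: "complex set set \<Rightarrow> (complex set \<times> complex set \<times> complex) set" where
  "meetings S = {(A, B, p). A \<in> S \<and> B \<in> S \<and> A \<noteq> B \<and> p \<in> A \<inter> B}"

lemma finite_meetings:
  assumes "finite S" "general_position S"
  shows "finite (meetings S)"
proof -
  have "meetings S = (SIGMA A:S. SIGMA B:S - {A}. A \<inter> B)" by (auto simp: meetings_def)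
  moreover have "finite (A \<inter> B)" if "A \<in> S" "B \<in> S - {A}" for A B
    using assms(2) that by (auto simp: general_position_def)
  ultimately show ?thesis using assms(1) by (simp only:) (intro finite_SigmaI finite_Diff; blast)
qed

lemma card_events_le:
  fixes u v :: "complex set \<Rightarrow> real"
  assumes "finite S" "general_position S"
  shows "card {(a, a', e). a \<in> S \<and> a' \<in> S \<and> a \<noteq> a' \<and> e \<in> Re ` (a \<inter> a') \<union> {u a, v a, u a', v a'}}
    \<le> card (meetings S) + 4 * (card S)\<^sup>2" (is "card ?X \<le> _")
proof -
  let ?I = "\<lambda>h. (\<lambda>(a, a'). (a, a', h a a')) ` (S \<times> S)"
  let ?M = "(\<lambda>(a, a', p). (a, a', Re p)) ` meetings S"
  let ?A = "?I (\<lambda>a a'. u a)" and ?B = "?I (\<lambda>a a'. v a)" and ?C = "?I (\<lambda>a a'. u a')" and ?D = "?I (\<lambda>a a'. v a')"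
  have fin: "finite ?M" "finite (?I h)" for h :: "complex set \<Rightarrow> complex set \<Rightarrow> real"
    using finite_meetings[OF assms] assms(1) by auto
  have I: "card (?I h) \<le> (card S)\<^sup>2" for h :: "complex set \<Rightarrow> complex set \<Rightarrow> real"
  proof -
    have "card (?I h) \<le> card (S \<times> S)" by (rule card_image_le) (simp add: assms(1))
    then show ?thesis by (simp add: card_cartesian_product power2_eq_square)
  qed
  have M: "card ?M \<le> card (meetings S)" by (rule card_image_le[OF finite_meetings[OF assms]])
  have "?X \<subseteq> ?M \<union> ?A \<union> ?B \<union> ?C \<union> ?D"
  proof (rule subsetI)
    fix z assume z: "z \<in> ?X"
    obtain a a' e where z': "z = (a, a', e)" by (cases z)
    with z have a: "(a, a') \<in> S \<times> S" "a \<noteq> a'" and e: "e \<in> Re ` (a \<inter> a') \<union> {u a, v a, u a', v a'}" by auto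
    have M: "z \<in> ?M" if e': "e \<in> Re ` (a \<inter> a')"
    proof -
      obtain p where "p \<in> a \<inter> a'" "e = Re p" using e' by blast
      then have "(a, a', p) \<in> meetings S" using a by (auto simp: meetings_def)
      then show ?thesis by (rule rev_image_eqI) (simp add: z' \<open>e = Re p\<close>)
    qed
    have I: "z \<in> ?I h" if "e = h a a'" for h
      using a(1) by (rule rev_image_eqI) (simp add: z' that)
    from e show "z \<in> ?M \<union> ?A \<union> ?B \<union> ?C \<union> ?D"
      using M I[of "\<lambda>a a'. u a"] I[of "\<lambda>a a'. v a"] I[of "\<lambda>a a'. u a'"] I[of "\<lambda>a a'. v a'"] by blast
  qed
  then have "card ?X \<le> card (?M \<union> ?A \<union> ?B \<union> ?C \<union> ?D)"
    by (intro card_mono finite_UnI fin)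
  also have "\<dots> \<le> card (?M \<union> ?A \<union> ?B \<union> ?C) + card ?D" by (rule card_Un_le)
  also have "card (?M \<union> ?A \<union> ?B \<union> ?C) \<le> card (?M \<union> ?A \<union> ?B) + card ?C" by (rule card_Un_le)
  also have "card (?M \<union> ?A \<union> ?B) \<le> card (?M \<union> ?A) + card ?B" by (rule card_Un_le)
  also have "card (?M \<union> ?A) \<le> card ?M + card ?A" by (rule card_Un_le)
  finally have "card ?X \<le> card ?M + card ?A + card ?B + card ?C + card ?D" by simp
  then show ?thesis using M I[of "\<lambda>a a'. u a"] I[of "\<lambda>a a'. v a"] I[of "\<lambda>a a'. u a'"] I[of "\<lambda>a a'. v a'"]
    by linarith
qed

text \<open>
  \<open>\<alpha>\<close> and \<open>\<beta>\<close> select an \<open>x\<close>-monotone arc \<open>(l, r, f)\<close> of every curve; \<open>A\<close> touches \<open>B\<close> from below along these arcs.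
\<close>

definition touches :: "complex set set \<Rightarrow> (complex set \<Rightarrow> real \<times> real \<times> (real \<Rightarrow> real)) \<Rightarrow>
    (complex set \<Rightarrow> real \<times> real \<times> (real \<Rightarrow> real)) \<Rightarrow> (complex set \<times> complex set) set" where
  "touches S \<alpha> \<beta> = {(A, B). A \<in> S \<and> B \<in> S \<and> A \<noteq> B \<and>
     (case \<alpha> A of (l, r, f) \<Rightarrow> case \<beta> B of (l', r', f') \<Rightarrow>
       (\<exists>p. A \<inter> B = {p} \<and> p \<in> graph_on l r f \<and> p \<in> graph_on l' r' f') \<and>
       (\<forall>t\<in>{l..r} \<inter> {l'..r'}. f t \<le> f' t))}"

text \<open>The assumption \<open>le\<close> turns the crude count of events, meetings plus four arc
  ends per ordered pair, into the bound \<open>K * card G\<close> required by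
  \<open>card_touchings_le\<close>. The work lies in the two separation conditions.\<close>

lemma card_touches_le:
  fixes K :: nat
  assumes fin: "finite S" and gp: "general_position S"
    and \<alpha>: "\<And>A l r f. A \<in> S \<Longrightarrow> \<alpha> A = (l, r, f) \<Longrightarrow> continuous_on {l..r} f \<and> graph_on l r f \<subseteq> A"
    and \<beta>: "\<And>A l r f. A \<in> S \<Longrightarrow> \<beta> A = (l, r, f) \<Longrightarrow> continuous_on {l..r} f \<and> graph_on l r f \<subseteq> A"
    and K: "K \<ge> 1" and le: "card (meetings S) + 4 * (card S)\<^sup>2 \<le> K * card (touches S \<alpha> \<beta>)"
  shows "card (touches S \<alpha> \<beta>) \<le> 16 * K * 2 ^ (2097152 * K ^ 4 + 1) * card S"
proof -
  define G where "G = touches S \<alpha> \<beta>"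
  define la ra fa where "la A = fst (\<alpha> A)" and "ra A = fst (snd (\<alpha> A))" and "fa A = snd (snd (\<alpha> A))" for A
  define lb rb fb where "lb A = fst (\<beta> A)" and "rb A = fst (snd (\<beta> A))" and "fb A = snd (snd (\<beta> A))" for A
  define x where "x A B = Re (the_elem (A \<inter> B))" for A B
  have conta: "continuous_on {la A..ra A} (fa A)" and suba: "graph_on (la A) (ra A) (fa A) \<subseteq> A" if "A \<in> S" for A
    using \<alpha>[OF that, of "la A" "ra A" "fa A"] by (auto simp: la_def ra_def fa_def)
  have contb: "continuous_on {lb A..rb A} (fb A)" and subb: "graph_on (lb A) (rb A) (fb A) \<subseteq> A" if "A \<in> S" for A
    using \<beta>[OF that, of "lb A" "rb A" "fb A"] by (auto simp: lb_def rb_def fb_def)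
  have GS: "A \<in> S" "B \<in> S" "A \<noteq> B" if "(A, B) \<in> G" for A B
    using that by (auto simp: G_def touches_def)
  have Gp: "\<exists>p. A \<inter> B = {p} \<and> p \<in> graph_on (la A) (ra A) (fa A) \<and> p \<in> graph_on (lb B) (rb B) (fb B)"
    and Gle: "\<And>s. s \<in> {la A..ra A} \<inter> {lb B..rb B} \<Longrightarrow> fa A s \<le> fb B s" if "(A, B) \<in> G" for A B
    using that by (auto simp: G_def touches_def la_def ra_def fa_def lb_def rb_def fb_def split: prod.splits)
  have Gx: "x A B \<in> {la A..ra A}" "x A B \<in> {lb B..rb B}" "fa A (x A B) = fb B (x A B)"
    "Complex (x A B) (fa A (x A B)) \<in> A \<inter> B" if G0: "(A, B) \<in> G" for A B
  proof -
    obtain p where p: "A \<inter> B = {p}" "p \<in> graph_on (la A) (ra A) (fa A)" "p \<in> graph_on (lb B) (rb B) (fb B)"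
      using Gp[OF G0] by blast
    then have "x A B = Re p" by (simp add: x_def)
    moreover have "Complex (Re p) (fa A (Re p)) = p" using p(2) by (simp add: mem_graph_on complex_eq_iff)
    ultimately show "x A B \<in> {la A..ra A}" "x A B \<in> {lb B..rb B}" "fa A (x A B) = fb B (x A B)"
      "Complex (x A B) (fa A (x A B)) \<in> A \<inter> B"
      using p by (auto simp: mem_graph_on)
  qed
  have three: False if "A \<in> S" "B \<in> S" "C \<in> S" "A \<noteq> B" "A \<noteq> C" "B \<noteq> C" "z \<in> A" "z \<in> B" "z \<in> C" for A B C z
  proof -
    have "A \<inter> B \<inter> C = {}" using gp that(1-6) unfolding general_position_def by blast
    then show False using that(7-9) by blast
  qed
  have finG: "finite G"
    by (rule finite_subset[of _ "S \<times> S"]) (use fin GS in auto)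
  define V where "V = (\<lambda>(A, B). x A B) ` G \<union> la ` S \<union> ra ` S \<union> lb ` S \<union> rb ` S"
  have "finite V" using finG fin by (simp add: V_def)
  then obtain \<epsilon> where \<epsilon>: "\<epsilon> > 0" "\<And>u v. u \<in> V \<Longrightarrow> v \<in> V \<Longrightarrow> u < v \<Longrightarrow> u + \<epsilon> < v"
    using finite_set_gap by blast
  have V: "x A B \<in> V" if "(A, B) \<in> G" for A B using that by (force simp: V_def)
  have V': "la A \<in> V" "ra A \<in> V" "lb A \<in> V" "rb A \<in> V" if "A \<in> S" for A using that by (auto simp: V_def)
  \<comment> \<open>An arc is imagined to run vertically to infinity (down for lower, up for upper arcs) just
    outside its \<open>x\<close>-range, so its end points count as events. The shift by \<open>\<epsilon>\<close> keeps them off the touching points.\<close>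
  define EA where "EA A B = Re ` (A \<inter> B) \<union> {la A - \<epsilon>, ra A + \<epsilon>, la B - \<epsilon>, ra B + \<epsilon>}" for A B
  define EB where "EB A B = Re ` (A \<inter> B) \<union> {lb A - \<epsilon>, rb A + \<epsilon>, lb B - \<epsilon>, rb B + \<epsilon>}" for A B
  have common: "e \<in> Re ` (B \<inter> B')" if "Complex e y \<in> B" "Complex e y \<in> B'" for e y B B'
    using that by (intro image_eqI[of _ _ "Complex e y"]) auto
  \<comment> \<open>Equal values would put three curves through one point, against general
    position.\<close>
  have neB: "fb B' (x A B) \<noteq> fb B (x A B)"
    if "(A, B) \<in> G" "(A, B') \<in> G" "B \<noteq> B'" "x A B \<in> {lb B'..rb B'}" for A B B'
  proof
    assume eq: "fb B' (x A B) = fb B (x A B)"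
    have "Complex (x A B) (fb B' (x A B)) \<in> B'"
      using subb[OF GS(2)[OF that(2)]] that(4) by (auto simp: mem_graph_on subset_iff)
    then show False
      using three[of A B B' "Complex (x A B) (fa A (x A B))"] GS[OF that(1)] GS[OF that(2)] Gx[OF that(1)] that(3) eq
      by simp
  qed
  have neA: "fa A' (x A B) \<noteq> fa A (x A B)"
    if "(A, B) \<in> G" "(A', B) \<in> G" "A \<noteq> A'" "x A B \<in> {la A'..ra A'}" for A A' B
  proof
    assume eq: "fa A' (x A B) = fa A (x A B)"
    have "Complex (x A B) (fa A' (x A B)) \<in> A'"
      using suba[OF GS(1)[OF that(2)]] that(4) by (auto simp: mem_graph_on subset_iff)
    then show False
      using three[of A B A' "Complex (x A B) (fa A (x A B))"] GS[OF that(1)] GS[OF that(2)] Gx[OF that(1)] that(3) eq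
      by simp
  qed
  have sepB': "\<exists>e\<in>EB B B'. x A B < e \<and> e < x A B'"
    if G1: "(A, B) \<in> G" and G2: "(A, B') \<in> G" and ne: "B \<noteq> B'" and lt: "x A B < x A B'" for A B B'
  proof -
    note S1 = GS[OF G1] and S2 = GS[OF G2]
    have "\<exists>e. x A B < e \<and> e < x A B' \<and> (e = lb B' - \<epsilon> \<or> e = rb B + \<epsilon> \<or>
        e \<in> {lb B..rb B} \<inter> {lb B'..rb B'} \<and> fb B e = fb B' e)"
    proof (rule touching_from_below_separated[where u = "la A" and v = "ra A" and f = "fa A"])
      show "x A B < lb B' - \<epsilon>" if "x A B < lb B'" using \<epsilon>(2)[OF V[OF G1] V'(3)[OF S2(2)] that] by simp
      show "rb B + \<epsilon> < x A B'" if "rb B < x A B'" using \<epsilon>(2)[OF V'(4)[OF S1(2)] V[OF G2] that] .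
      show "fb B' (x A B) \<noteq> fb B (x A B)" if "x A B \<in> {lb B'..rb B'}" by (rule neB[OF G1 G2 ne that])
      show "fb B (x A B') \<noteq> fb B' (x A B')" if "x A B' \<in> {lb B..rb B}" by (rule neB[OF G2 G1 ne[symmetric] that])
    qed (use contb S1 S2 Gx[OF G1] Gx[OF G2] Gle[OF G1] Gle[OF G2] \<epsilon>(1) lt in auto)
    then obtain e where e: "x A B < e" "e < x A B'" "e = lb B' - \<epsilon> \<or> e = rb B + \<epsilon> \<or>
        e \<in> {lb B..rb B} \<inter> {lb B'..rb B'} \<and> fb B e = fb B' e" by blast
    have "e \<in> Re ` (B \<inter> B')" if "e \<in> {lb B..rb B} \<inter> {lb B'..rb B'}" "fb B e = fb B' e"
    proof (rule common)
      show "Complex e (fb B e) \<in> B" using subb[OF S1(2)] that by (auto simp: mem_graph_on subset_iff)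
      show "Complex e (fb B e) \<in> B'" using subb[OF S2(2)] that by (auto simp: mem_graph_on subset_iff)
    qed
    then have "e \<in> EB B B'" using e(3) by (auto simp: EB_def)
    then show ?thesis using e by blast
  qed
  have sepA': "\<exists>e\<in>EA A A'. x A B < e \<and> e < x A' B"
    if G1: "(A, B) \<in> G" and G2: "(A', B) \<in> G" and ne: "A \<noteq> A'" and lt: "x A B < x A' B" for A A' B
  proof -
    note S1 = GS[OF G1] and S2 = GS[OF G2]
    \<comment> \<open>Reflection in the horizontal axis exchanges lower and upper arcs, hence the
      minus signs.\<close>
    have "\<exists>e. x A B < e \<and> e < x A' B \<and> (e = la A' - \<epsilon> \<or> e = ra A + \<epsilon> \<or>
        e \<in> {la A..ra A} \<inter> {la A'..ra A'} \<and> - fa A e = - fa A' e)"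
    proof (rule touching_from_below_separated[where u = "lb B" and v = "rb B" and f = "\<lambda>s. - fb B s"])
      show "x A B < la A' - \<epsilon>" if "x A B < la A'" using \<epsilon>(2)[OF V[OF G1] V'(1)[OF S2(1)] that] by simp
      show "ra A + \<epsilon> < x A' B" if "ra A < x A' B" using \<epsilon>(2)[OF V'(2)[OF S1(1)] V[OF G2] that] .
      show "- fa A' (x A B) \<noteq> - fa A (x A B)" if "x A B \<in> {la A'..ra A'}" using neA[OF G1 G2 ne that] by simp
      show "- fa A (x A' B) \<noteq> - fa A' (x A' B)" if "x A' B \<in> {la A..ra A}" using neA[OF G2 G1 ne[symmetric] that] by simp
    qed (use conta S1 S2 Gx[OF G1] Gx[OF G2] Gle[OF G1] Gle[OF G2] \<epsilon>(1) lt in \<open>auto intro!: continuous_on_minus\<close>)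
    then obtain e where e: "x A B < e" "e < x A' B" "e = la A' - \<epsilon> \<or> e = ra A + \<epsilon> \<or>
        e \<in> {la A..ra A} \<inter> {la A'..ra A'} \<and> fa A e = fa A' e" by auto
    have "e \<in> Re ` (A \<inter> A')" if "e \<in> {la A..ra A} \<inter> {la A'..ra A'}" "fa A e = fa A' e"
    proof (rule common)
      show "Complex e (fa A e) \<in> A" using suba[OF S1(1)] that by (auto simp: mem_graph_on subset_iff)
      show "Complex e (fa A e) \<in> A'" using suba[OF S2(1)] that by (auto simp: mem_graph_on subset_iff)
    qed
    then have "e \<in> EA A A'" using e(3) by (auto simp: EA_def)
    then show ?thesis using e by blast
  qed
  have symE: "EA A B = EA B A" "EB A B = EB B A" for A B by (auto simp: EA_def EB_def)
  have finE: "finite (EA A B)" "finite (EB A B)" if "A \<in> S" "B \<in> S" "A \<noteq> B" for A B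
    using gp that by (auto simp: EA_def EB_def general_position_def)
  interpret touching_system G x EA EB
  proof
    show "finite G" by (rule finG)
    show "finite (EA A B)" if "A \<in> fst ` G" "B \<in> fst ` G" "A \<noteq> B" for A B
      using that GS by (intro finE) auto
    show "finite (EB A B)" if "A \<in> snd ` G" "B \<in> snd ` G" "A \<noteq> B" for A B
      using that GS by (intro finE) auto
    show "\<exists>e\<in>EA A A'. min (x A B) (x A' B) < e \<and> e < max (x A B) (x A' B)"
      if "(A, B) \<in> G" "(A', B) \<in> G" "A \<noteq> A'" for A A' B
    proof (cases "x A B" "x A' B" rule: linorder_cases)
      case less
      then show ?thesis using sepA'[OF that] by auto
    next
      case equal
      then show ?thesis using neA[OF that] Gx[OF that(1)] Gx[OF that(2)] by auto
    next
      case greater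
      then show ?thesis using sepA'[OF that(2,1) that(3)[symmetric]] symE by (auto simp: min_def max_def)
    qed
    show "\<exists>e\<in>EB B B'. min (x A B) (x A B') < e \<and> e < max (x A B) (x A B')"
      if "(A, B) \<in> G" "(A, B') \<in> G" "B \<noteq> B'" for A B B'
    proof (cases "x A B" "x A B'" rule: linorder_cases)
      case less
      then show ?thesis using sepB'[OF that] by auto
    next
      case equal
      then show ?thesis using neB[OF that] Gx[OF that(1)] Gx[OF that(2)] by auto
    next
      case greater
      then show ?thesis using sepB'[OF that(2,1) that(3)[symmetric]] symE by (auto simp: min_def max_def)
    qed
  qed
  have GS': "fst ` G \<subseteq> S" "snd ` G \<subseteq> S" using GS by auto
  have finEv: "finite {(a, a', e). a \<in> S \<and> a' \<in> S \<and> a \<noteq> a' \<and> e \<in> E a a'}"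
    if "\<And>a a'. a \<in> S \<Longrightarrow> a' \<in> S \<Longrightarrow> a \<noteq> a' \<Longrightarrow> finite (E a a')" for E :: "complex set \<Rightarrow> complex set \<Rightarrow> real set"
  proof -
    have "{(a, a', e). a \<in> S \<and> a' \<in> S \<and> a \<noteq> a' \<and> e \<in> E a a'} = (SIGMA a:S. SIGMA a':S - {a}. E a a')" by auto
    then show ?thesis using fin by (simp only:) (intro finite_SigmaI finite_Diff that; auto)
  qed
  have "card EvA \<le> card {(a, a', e). a \<in> S \<and> a' \<in> S \<and> a \<noteq> a' \<and> e \<in> EA a a'}"
    using GS' by (intro card_mono finEv finE) (auto simp: EvA_def)
  also have "\<dots> \<le> card (meetings S) + 4 * (card S)\<^sup>2"
    unfolding EA_def by (rule card_events_le[OF fin gp])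
  finally have XA: "card EvA \<le> K * card G" using le by (simp add: G_def)
  have "card EvB \<le> card {(a, a', e). a \<in> S \<and> a' \<in> S \<and> a \<noteq> a' \<and> e \<in> EB a a'}"
    using GS' by (intro card_mono finEv finE) (auto simp: EvB_def)
  also have "\<dots> \<le> card (meetings S) + 4 * (card S)\<^sup>2"
    unfolding EB_def by (rule card_events_le[OF fin gp])
  finally have XB: "card EvB \<le> K * card G" using le by (simp add: G_def)
  have "card G \<le> 16 * K * 2 ^ (2097152 * K ^ 4 + 1) * card (fst ` G)"
    by (rule card_touchings_le[OF K XA XB])
  also have "\<dots> \<le> 16 * K * 2 ^ (2097152 * K ^ 4 + 1) * card S"
    by (intro mult_le_mono2 card_mono fin GS'(1))
  finally show ?thesis by (simp add: G_def)
qed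

section \<open>From common points to the total count\<close>

lemma intersection_points_eq:
  "intersection_points S = (\<lambda>(A, B, p). p) ` meetings S"
proof -
  \<comment> \<open>A common point that is not a touching point is a crossing point, so the two
    kinds exhaust the common points.\<close>
  have iff: "intersection_point A B p \<longleftrightarrow> p \<in> A \<inter> B" for A B p
    by (auto simp: intersection_point_def crossing_point_def touching_point_def)
  show ?thesis
  proof (intro set_eqI iffI)
    fix p assume "p \<in> intersection_points S"
    then obtain A B where "(A, B, p) \<in> meetings S"
      by (auto simp: intersection_points_def meetings_def iff)
    then show "p \<in> (\<lambda>(A, B, p). p) ` meetings S" by (rule rev_image_eqI) simp
  qed (auto simp: intersection_points_def meetings_def iff)
qed

text \<open>By general position an intersection point lies on exactly two curves, so it occurs in
  two meetings, one for each order.\<close>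

lemma card_meetings_le:
  assumes "finite S" "general_position S"
  shows "card (meetings S) \<le> 2 * card (intersection_points S)"
proof -
  have "1 * card (meetings S) \<le> 2 * card (intersection_points S)"
  proof (rule card_double_count_le[where R = "\<lambda>(A, B, p) q. p = q"])
    show "finite (meetings S)" by (rule finite_meetings[OF assms])
    then show fin: "finite (intersection_points S)" unfolding intersection_points_eq by (rule finite_imageI)
    fix m assume m: "m \<in> meetings S"
    obtain A B p where m': "m = (A, B, p)" by (cases m)
    have "p \<in> intersection_points S" using m m' unfolding intersection_points_eq by force
    then have "{q \<in> intersection_points S. p = q} = {p}" by auto
    then show "1 \<le> card {q \<in> intersection_points S. (case m of (A, B, p) \<Rightarrow> \<lambda>q. p = q) q}"
      by (simp add: m')
  next
    fix q assume "q \<in> intersection_points S"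
    then obtain A B where AB: "A \<in> S" "B \<in> S" "A \<noteq> B" "q \<in> A" "q \<in> B"
      unfolding intersection_points_eq meetings_def by auto
    have "{m \<in> meetings S. (case m of (A, B, p) \<Rightarrow> \<lambda>q. p = q) q} \<subseteq> {(A, B, q), (B, A, q)}"
    proof
      fix m assume m: "m \<in> {m \<in> meetings S. (case m of (A, B, p) \<Rightarrow> \<lambda>q. p = q) q}"
      then obtain A' B' where m': "m = (A', B', q)" "A' \<in> S" "B' \<in> S" "A' \<noteq> B'" "q \<in> A'" "q \<in> B'"
        by (auto simp: meetings_def)
      have only: "D \<in> {A, B}" if "D \<in> S" "q \<in> D" for D
      proof (rule ccontr)
        assume "D \<notin> {A, B}"
        then have "A \<inter> B \<inter> D = {}" using assms(2) AB that(1) unfolding general_position_def by blast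
        then show False using AB that by blast
      qed
      show "m \<in> {(A, B, q), (B, A, q)}" using only[of A'] only[of B'] m' by auto
    qed
    then have "card {m \<in> meetings S. (case m of (A, B, p) \<Rightarrow> \<lambda>q. p = q) q} \<le> card {(A, B, q), (B, A, q)}"
      by (intro card_mono) auto
    also have "\<dots> = 2"
      unfolding card_2_iff by (rule exI[of _ "(A, B, q)"], rule exI[of _ "(B, A, q)"]) (simp add: AB(3))
    finally show "card {m \<in> meetings S. (case m of (A, B, p) \<Rightarrow> \<lambda>q. p = q) q} \<le> 2" .
  qed
  then show ?thesis by simp
qed

definition single_pairs :: "complex set set \<Rightarrow> (complex set \<times> complex set) set" where
  "single_pairs S = {(A, B). A \<in> S \<and> B \<in> S \<and> A \<noteq> B \<and> card (A \<inter> B) = 1}"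

text \<open>An ordered pair of distinct curves has two common points or more, or else one and an
  entry in \<open>single_pairs S\<close>, so it contributes at least 2. The term
  \<open>2 * card S\<close> stands for the pairs \<open>(A, A)\<close> in the square.\<close>

lemma card_meetings_ge:
  assumes "finite S" "general_position S" "pairwise_intersecting S"
  shows "2 * (card S)\<^sup>2 \<le> card (meetings S) + card (single_pairs S) + 2 * card S"
proof -
  define P where "P = (SIGMA A:S. S - {A})"
  have finP: "finite P" using assms(1) by (auto simp: P_def)
  have "card P = (\<Sum>A\<in>S. card (S - {A}))" unfolding P_def using assms(1) by (intro card_SigmaI) auto
  also have "\<dots> = card S * (card S - 1)" by simp
  finally have cP: "card P + card S = (card S)\<^sup>2"
    by (cases "card S") (simp_all add: power2_eq_square)
  have fin: "finite (A \<inter> B)" "A \<inter> B \<noteq> {}" if "(A, B) \<in> P" for A B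
    using that assms(2,3) by (auto simp: P_def general_position_def pairwise_intersecting_def pairwise_def)
  have "meetings S = (\<lambda>((A, B), p). (A, B, p)) ` (SIGMA AB:P. fst AB \<inter> snd AB)"
  proof (intro equalityI subsetI)
    fix z assume "z \<in> meetings S"
    then obtain A B p where z: "z = (A, B, p)" "((A, B), p) \<in> (SIGMA AB:P. fst AB \<inter> snd AB)"
      by (auto simp: meetings_def P_def)
    from z(2) show "z \<in> (\<lambda>((A, B), p). (A, B, p)) ` (SIGMA AB:P. fst AB \<inter> snd AB)"
      by (rule rev_image_eqI) (simp add: z(1))
  qed (auto simp: meetings_def P_def)
  moreover have "inj_on (\<lambda>((A, B), p). (A, B, p)) (SIGMA AB:P. fst AB \<inter> snd AB)"
    by (auto simp: inj_on_def)
  ultimately have "card (meetings S) = card (SIGMA AB:P. fst AB \<inter> snd AB)"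
    by (simp add: card_image)
  also have "\<dots> = (\<Sum>AB\<in>P. card (fst AB \<inter> snd AB))"
    using finP fin by (intro card_SigmaI) auto
  finally have cM: "card (meetings S) = (\<Sum>AB\<in>P. card (fst AB \<inter> snd AB))" .
  have eq: "single_pairs S = {AB \<in> P. card (fst AB \<inter> snd AB) = 1}"
    by (auto simp: single_pairs_def P_def)
  have cS: "card (single_pairs S) = (\<Sum>AB\<in>P. if card (fst AB \<inter> snd AB) = 1 then 1 else 0)"
    unfolding eq by (rule trans[OF card_eq_sum sum.inter_filter[OF finP]])
  have "2 * card P = (\<Sum>AB\<in>P. 2)" by simp
  also have "\<dots> \<le> (\<Sum>AB\<in>P. card (fst AB \<inter> snd AB) + (if card (fst AB \<inter> snd AB) = 1 then 1 else 0))"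
  proof (rule sum_mono)
    fix AB assume "AB \<in> P"
    then have "card (fst AB \<inter> snd AB) > 0" using fin[of "fst AB" "snd AB"] by (simp add: card_gt_0_iff)
    then show "2 \<le> card (fst AB \<inter> snd AB) + (if card (fst AB \<inter> snd AB) = 1 then 1 else 0)" by auto
  qed
  also have "\<dots> = card (meetings S) + card (single_pairs S)"
    by (simp only: sum.distrib cM cS)
  finally show ?thesis using cP by linarith
qed

lemma x_monotone_decomposition:
  assumes "x_monotone_decomposable k C" "closed_curve C"
  shows "\<exists>\<alpha>. (\<forall>i l r f. i < k \<longrightarrow> \<alpha> i = (l, r, f) \<longrightarrow> continuous_on {l..r} f \<and> graph_on l r f \<subseteq> C) \<and>
    (\<forall>p\<in>C. \<exists>i<k. case \<alpha> i of (l, r, f) \<Rightarrow> p \<in> graph_on l r f)"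
proof -
  from assms(1) obtain \<A> where \<A>: "finite \<A>" "card \<A> \<le> k" "\<forall>A\<in>\<A>. x_monotone A" "C = \<Union>\<A>"
    by (auto simp: x_monotone_decomposable_def)
  have "C \<noteq> {}" using assms(2) by (auto simp: closed_curve_def)
  then obtain A0 where A0: "A0 \<in> \<A>" using \<A>(4) by auto
  obtain h where h: "bij_betw h {0..<card \<A>} \<A>" using ex_bij_betw_nat_finite[OF \<A>(1)] by blast
  \<comment> \<open>Decompositions with fewer than \<open>k\<close> arcs are padded by repeating
    \<open>A0\<close>, so that all curves share one index range.\<close>
  define a where "a i = (if i < card \<A> then h i else A0)" for i
  have a\<A>: "a i \<in> \<A>" for i using h A0 by (auto simp: a_def bij_betw_def)
  have surj: "\<exists>i<k. a i = A" if "A \<in> \<A>" for A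
  proof -
    have "A \<in> h ` {0..<card \<A>}" using h that by (simp add: bij_betw_def)
    then obtain i where "i < card \<A>" "A = h i" by auto
    then show ?thesis using \<A>(2) by (intro exI[of _ i]) (simp add: a_def)
  qed
  have "\<exists>g. case g of (l, r, f) \<Rightarrow> continuous_on {l..r} f \<and> a i = graph_on l r f" for i
  proof -
    obtain l r f where "continuous_on {l..r} f" "a i = graph_on l r f"
      using x_monotone_graph \<A>(3) a\<A> by metis
    then show ?thesis by (intro exI[of _ "(l, r, f)"]) simp
  qed
  then have "\<forall>i. \<exists>g. case g of (l, r, f) \<Rightarrow> continuous_on {l..r} f \<and> a i = graph_on l r f" ..
  from choice[OF this] obtain \<alpha> where
    \<alpha>: "\<forall>i. case \<alpha> i of (l, r, f) \<Rightarrow> continuous_on {l..r} f \<and> a i = graph_on l r f" ..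
  show ?thesis
  proof (intro exI[of _ \<alpha>] conjI allI impI ballI)
    fix i l r f assume "\<alpha> i = (l, r, f)"
    then have "continuous_on {l..r} f" "a i = graph_on l r f" using spec[OF \<alpha>, of i] by auto
    then show "continuous_on {l..r} f" "graph_on l r f \<subseteq> C" using a\<A>[of i] \<A>(4) by auto
  next
    fix p assume "p \<in> C"
    then obtain A where "A \<in> \<A>" "p \<in> A" using \<A>(4) by auto
    then obtain i where "i < k" "p \<in> a i" using surj by blast
    then show "\<exists>i<k. case \<alpha> i of (l, r, f) \<Rightarrow> p \<in> graph_on l r f"
      using spec[OF \<alpha>, of i] by (intro exI[of _ i]) (auto split: prod.splits)
  qed
qed

text \<open>At the only common point some arcs \<open>i\<close> and \<open>j\<close> of the two
  curves meet, and they are comparable. If the first curve has the upper arc, the pair is found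
  after a swap; hence the factor 2.\<close>

lemma card_single_pairs_le:
  fixes k :: nat
  assumes fin: "finite S" and closed: "\<And>C. C \<in> S \<Longrightarrow> closed_curve C"
    and \<alpha>: "\<And>C i l r f. C \<in> S \<Longrightarrow> i < k \<Longrightarrow> \<alpha> C i = (l, r, f) \<Longrightarrow>
      continuous_on {l..r} f \<and> graph_on l r f \<subseteq> C"
    and cover: "\<And>C p. C \<in> S \<Longrightarrow> p \<in> C \<Longrightarrow> \<exists>i<k. case \<alpha> C i of (l, r, f) \<Rightarrow> p \<in> graph_on l r f"
  shows "card (single_pairs S) \<le>
    2 * (\<Sum>(i, j)\<in>{..<k} \<times> {..<k}. card (touches S (\<lambda>C. \<alpha> C i) (\<lambda>C. \<alpha> C j)))"
proof -
  let ?T = "\<lambda>(i, j). touches S (\<lambda>C. \<alpha> C i) (\<lambda>C. \<alpha> C j)"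
  let ?U = "\<Union> (?T ` ({..<k} \<times> {..<k}))"
  have "finite (touches S \<beta> \<gamma>)" for \<beta> \<gamma>
    by (rule finite_subset[of _ "S \<times> S"]) (auto simp: touches_def fin)
  then have finT: "finite (?T ij)" for ij by (cases ij) simp
  then have finU: "finite ?U"
    by (intro finite_UN_I finite_cartesian_product) simp_all
  have "single_pairs S \<subseteq> ?U \<union> prod.swap ` ?U"
  proof
    fix z assume "z \<in> single_pairs S"
    then obtain A B p where z: "z = (A, B)" "A \<in> S" "B \<in> S" "A \<noteq> B" and p: "A \<inter> B = {p}"
      by (auto simp: single_pairs_def card_1_singleton_iff)
    have "p \<in> A" "p \<in> B" using p by auto
    from cover[OF z(2) \<open>p \<in> A\<close>] obtain i where
      i: "i < k" "case \<alpha> A i of (l, r, f) \<Rightarrow> p \<in> graph_on l r f" by (elim exE conjE)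
    from cover[OF z(3) \<open>p \<in> B\<close>] obtain j where
      j: "j < k" "case \<alpha> B j of (l, r, f) \<Rightarrow> p \<in> graph_on l r f" by (elim exE conjE)
    obtain l r f where A: "\<alpha> A i = (l, r, f)" by (cases "\<alpha> A i")
    obtain l' r' f' where B: "\<alpha> B j = (l', r', f')" by (cases "\<alpha> B j")
    have pA: "p \<in> graph_on l r f" and pB: "p \<in> graph_on l' r' f'" using i(2) j(2) A B by auto
    have "(\<forall>t\<in>{l..r} \<inter> {l'..r'}. f t \<le> f' t) \<or> (\<forall>t\<in>{l..r} \<inter> {l'..r'}. f' t \<le> f t)"
      using \<alpha>[OF z(2) i(1) A] \<alpha>[OF z(3) j(1) B] pA pB
      by (intro touching_graphs_comparable[OF closed[OF z(2)] closed[OF z(3)] p]) auto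
    then show "z \<in> ?U \<union> prod.swap ` ?U"
    proof
      assume "\<forall>t\<in>{l..r} \<inter> {l'..r'}. f t \<le> f' t"
      then have "z \<in> ?T (i, j)" using z p A B pA pB by (simp add: touches_def)
      moreover have "(i, j) \<in> {..<k} \<times> {..<k}" using i(1) j(1) by simp
      ultimately have "z \<in> ?U" by (rule UN_I[rotated])
      then show ?thesis by blast
    next
      assume "\<forall>t\<in>{l..r} \<inter> {l'..r'}. f' t \<le> f t"
      moreover have "B \<inter> A = {p}" using p by auto
      ultimately have "(B, A) \<in> ?T (j, i)" using z A B pA pB by (simp add: touches_def Int_commute)
      moreover have "(j, i) \<in> {..<k} \<times> {..<k}" using i(1) j(1) by simp
      ultimately have "(B, A) \<in> ?U" by (rule UN_I[rotated])
      then have "z \<in> prod.swap ` ?U" by (rule rev_image_eqI) (simp add: z(1))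
      then show ?thesis by blast
    qed
  qed
  then have "card (single_pairs S) \<le> card (?U \<union> prod.swap ` ?U)"
    by (intro card_mono finite_UnI finU finite_imageI)
  also have "\<dots> \<le> card ?U + card (prod.swap ` ?U)" by (rule card_Un_le)
  also have "card (prod.swap ` ?U) \<le> card ?U" by (rule card_image_le[OF finU])
  also have "card ?U \<le> (\<Sum>ij\<in>{..<k} \<times> {..<k}. card (?T ij))"
    by (rule card_UN_le) simp
  finally show ?thesis by (simp add: case_prod_beta)
qed

theorem theorem1:
  fixes k :: nat
  assumes "k \<ge> 1"
  shows "\<forall>\<delta>::real. \<delta> > 0 \<longrightarrow>
    (\<exists>n0::nat. \<forall>n\<ge>n0. \<forall>S::complex set set.
       finite S \<and> card S = n \<and>
       (\<forall>C\<in>S. closed_curve C \<and> x_monotone_decomposable k C) \<and>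
       pairwise_intersecting S \<and> general_position S \<longrightarrow>
       real (card (intersection_points S)) \<ge> (1 - \<delta>) * real n ^ 2)"
proof (intro allI impI)
  fix \<delta> :: real assume \<delta>: "\<delta> > 0"
  \<comment> \<open>With few intersections there are at most \<open>6 * n^2\<close> events, and some
    pair of indices has at least \<open>\<delta> * n^2 / (2 * k^2)\<close> touchings;
    \<open>K\<close> exceeds the ratio.\<close>
  define K where "K = nat \<lceil>12 * real k ^ 2 / \<delta>\<rceil> + 1"
  define M where "M = 16 * K * 2 ^ (2097152 * K ^ 4 + 1)"
  \<comment> \<open>The first summand makes the loss \<open>2 * n\<close> at most
    \<open>\<delta> * n^2\<close>; the second makes the linear bound \<open>M * n\<close> too small
    for the quadratic number of touchings.\<close>
  define n0 where "n0 = nat \<lceil>2 / \<delta>\<rceil> + nat \<lceil>2 * real k ^ 2 * real M / \<delta>\<rceil> + 1"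
  have K: "12 * real k ^ 2 / \<delta> \<le> real K" "K \<ge> 1" unfolding K_def by linarith+
  show "\<exists>n0. \<forall>n\<ge>n0. \<forall>S. finite S \<and> card S = n \<and>
      (\<forall>C\<in>S. closed_curve C \<and> x_monotone_decomposable k C) \<and>
      pairwise_intersecting S \<and> general_position S \<longrightarrow>
      real (card (intersection_points S)) \<ge> (1 - \<delta>) * real n ^ 2"
  proof (rule exI[of _ n0], intro allI impI, rule ccontr)
    fix n S assume n: "n0 \<le> n"
      and S: "finite S \<and> card S = n \<and> (\<forall>C\<in>S. closed_curve C \<and> x_monotone_decomposable k C) \<and>
        pairwise_intersecting S \<and> general_position S"
      and few: "\<not> (1 - \<delta>) * real n ^ 2 \<le> real (card (intersection_points S))"
    have fin: "finite S" and cS: "card S = n" and gp: "general_position S"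
      and pi: "pairwise_intersecting S" and closed: "\<And>C. C \<in> S \<Longrightarrow> closed_curve C"
      and dec: "\<And>C. C \<in> S \<Longrightarrow> x_monotone_decomposable k C" using S by auto
    have "2 / \<delta> \<le> real n0" "2 * real k ^ 2 * real M / \<delta> < real n0" unfolding n0_def by linarith+
    then have n_ge: "2 / \<delta> \<le> real n" "2 * real k ^ 2 * real M / \<delta> < real n" using n by linarith+
    have n_pos: "real n > 0" using n by (simp add: n0_def)
    have k_pos: "real k ^ 2 > 0" using assms by simp
    have "\<forall>C\<in>S. \<exists>\<alpha>. (\<forall>i l r f. i < k \<longrightarrow> \<alpha> i = (l, r, f) \<longrightarrow> continuous_on {l..r} f \<and> graph_on l r f \<subseteq> C) \<and>
        (\<forall>p\<in>C. \<exists>i<k. case \<alpha> i of (l, r, f) \<Rightarrow> p \<in> graph_on l r f)"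
      by (intro ballI x_monotone_decomposition dec closed)
    from bchoice[OF this] obtain \<alpha> where \<alpha>: "\<forall>C\<in>S.
        (\<forall>i l r f. i < k \<longrightarrow> \<alpha> C i = (l, r, f) \<longrightarrow> continuous_on {l..r} f \<and> graph_on l r f \<subseteq> C) \<and>
        (\<forall>p\<in>C. \<exists>i<k. case \<alpha> C i of (l, r, f) \<Rightarrow> p \<in> graph_on l r f)" ..
    have \<alpha>1: "continuous_on {l..r} f \<and> graph_on l r f \<subseteq> C" if "C \<in> S" "i < k" "\<alpha> C i = (l, r, f)" for C i l r f
      using bspec[OF \<alpha> that(1)] that(2,3) by blast
    have \<alpha>2: "\<exists>i<k. case \<alpha> C i of (l, r, f) \<Rightarrow> p \<in> graph_on l r f" if "C \<in> S" "p \<in> C" for C p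
      using bspec[OF \<alpha> that(1)] that(2) by blast
    define T where "T i j = card (touches S (\<lambda>C. \<alpha> C i) (\<lambda>C. \<alpha> C j))" for i j
    have "real (card (meetings S)) \<le> real (2 * card (intersection_points S))"
      using card_meetings_le[OF fin gp] by (simp only: of_nat_le_iff)
    then have "real (card (meetings S)) \<le> 2 * real (card (intersection_points S))" by simp
    with few have X1: "real (card (meetings S)) \<le> 2 * ((1 - \<delta>) * real n ^ 2)" by linarith
    have "real (2 * (card S)\<^sup>2) \<le> real (card (meetings S) + card (single_pairs S) + 2 * card S)"
      using card_meetings_ge[OF fin gp pi] by (simp only: of_nat_le_iff)
    then have "2 * real n ^ 2 \<le> real (card (meetings S)) + real (card (single_pairs S)) + 2 * real n"
      by (simp add: cS)
    with X1 have "2 * \<delta> * real n ^ 2 - 2 * real n \<le> real (card (single_pairs S))"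
      by (simp add: algebra_simps)
    moreover have "2 * real n \<le> \<delta> * real n ^ 2"
    proof -
      have "2 \<le> \<delta> * real n" using n_ge(1) \<delta> by (simp add: field_simps)
      then show ?thesis using mult_right_mono[of 2 "\<delta> * real n" "real n"] by (simp add: power2_eq_square)
    qed
    ultimately have singles: "\<delta> * real n ^ 2 \<le> real (card (single_pairs S))" by linarith
    have "card (single_pairs S) \<le> 2 * (\<Sum>(i, j)\<in>{..<k} \<times> {..<k}. T i j)"
      unfolding T_def by (rule card_single_pairs_le[OF fin closed \<alpha>1 \<alpha>2])
    also have "(\<Sum>(i, j)\<in>{..<k} \<times> {..<k}. T i j) = (\<Sum>ij\<in>{..<k} \<times> {..<k}. T (fst ij) (snd ij))"
      by (simp add: case_prod_beta)
    finally have sum_T: "card (single_pairs S) \<le> 2 * (\<Sum>ij\<in>{..<k} \<times> {..<k}. T (fst ij) (snd ij))" .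
    obtain i j where ij: "i < k" "j < k" "\<delta> * real n ^ 2 \<le> 2 * real k ^ 2 * real (T i j)"
    proof (rule ccontr)
      assume "\<not> thesis"
      then have small: "2 * real k ^ 2 * real (T i j) < \<delta> * real n ^ 2" if "i < k" "j < k" for i j
        using that(1,2) \<open>\<And>i j. i < k \<Longrightarrow> j < k \<Longrightarrow> \<delta> * real n ^ 2 \<le> 2 * real k ^ 2 * real (T i j) \<Longrightarrow> thesis\<close>
        by (meson not_le)
      have "(\<Sum>ij\<in>{..<k} \<times> {..<k}. 2 * real k ^ 2 * real (T (fst ij) (snd ij)))
          < (\<Sum>ij\<in>{..<k} \<times> {..<k}. \<delta> * real n ^ 2)"
        using small assms by (intro sum_strict_mono) (auto simp: lessThan_empty_iff)
      also have "\<dots> = real k ^ 2 * (\<delta> * real n ^ 2)"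
        by (simp add: card_cartesian_product power2_eq_square)
      finally have "real k ^ 2 * (2 * (\<Sum>ij\<in>{..<k} \<times> {..<k}. real (T (fst ij) (snd ij)))) < real k ^ 2 * (\<delta> * real n ^ 2)"
        by (simp add: sum_distrib_left algebra_simps)
      then have "2 * (\<Sum>ij\<in>{..<k} \<times> {..<k}. real (T (fst ij) (snd ij))) < \<delta> * real n ^ 2"
        using k_pos by (simp only: mult_less_cancel_left_pos)
      moreover have "real (card (single_pairs S)) \<le> real (2 * (\<Sum>ij\<in>{..<k} \<times> {..<k}. T (fst ij) (snd ij)))"
        using sum_T by (simp only: of_nat_le_iff)
      then have "real (card (single_pairs S)) \<le> 2 * (\<Sum>ij\<in>{..<k} \<times> {..<k}. real (T (fst ij) (snd ij)))"
        by (simp only: of_nat_mult of_nat_sum of_nat_numeral)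
      ultimately show False using singles by linarith
    qed
    have "real (card (meetings S) + 4 * (card S)\<^sup>2) \<le> real (K * T i j)"
    proof -
      have "0 \<le> \<delta> * real n ^ 2" using \<delta> by simp
      then have "2 * ((1 - \<delta>) * real n ^ 2) \<le> 2 * real n ^ 2" by (simp add: algebra_simps)
      then have "real (card (meetings S) + 4 * (card S)\<^sup>2) \<le> 6 * real n ^ 2"
        using X1 by (simp add: cS)
      also have "\<dots> \<le> (12 * real k ^ 2 / \<delta>) * real (T i j)"
        using ij(3) \<delta> by (simp add: field_simps)
      also have "\<dots> \<le> real K * real (T i j)" using K(1) by (rule mult_right_mono) simp
      finally show ?thesis by simp
    qed
    then have events: "card (meetings S) + 4 * (card S)\<^sup>2 \<le> K * T i j" by (simp only: of_nat_le_iff)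
    have "T i j \<le> M * card S"
      unfolding T_def M_def by (rule card_touches_le[OF fin gp \<alpha>1[OF _ ij(1)] \<alpha>1[OF _ ij(2)] K(2) events[unfolded T_def]])
    then have "real (T i j) \<le> real (M * card S)" by (simp only: of_nat_le_iff)
    then have "real (T i j) \<le> real M * real n" by (simp only: of_nat_mult cS)
    then have "2 * real k ^ 2 * real (T i j) \<le> 2 * real k ^ 2 * (real M * real n)"
      by (intro mult_left_mono) auto
    with ij(3) have "(\<delta> * real n) * real n \<le> (2 * real k ^ 2 * real M) * real n"
      by (simp add: power2_eq_square algebra_simps)
    then have "\<delta> * real n \<le> 2 * real k ^ 2 * real M" using n_pos by (simp only: mult_le_cancel_right_pos)
    then have "real n \<le> 2 * real k ^ 2 * real M / \<delta>" using \<delta> by (simp add: field_simps)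
    with n_ge(2) show False by linarith
  qed
qed

end
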